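(* Let $\Bbbk$ be a field, $\Gamma=(V,E)$ a connected graph and $v$ a collection of skew-zigzag coefficients for $\Gamma$. (1) If $\Gamma$ has only one vertex, then $\{1,X\}$ is a basis of $A_v(\Gamma)$. (2) If $\Gamma$ has two vertices $a$ and $b$, then $\{[a],[b],[a\,|\,b],[b\,|\,a],[a\,|\,b\,|\,a],[b\,|\,a\,|\,b]\}$ is a basis of $A_v(\Gamma)$. (3) If $\Gamma$ has three or more vertices, for every $x\in V$ let $V_x$ be the set of all vertices connected to $x$ by an edge, and fix a vertex $y_x\in V_x$. Then $$J=\{[a],\,[b\,|\,c],\,[x\,|\,y_x\,|\,x] : a,x\in V,\ \{b,c\}\in E\}$$ (where $[b\,|\,c]$ ranges over all ordered pairs $(b,c)$ with $\{b,c\}\in E$) is a basis of $A_v(\Gamma)$. In particular, $\dim A_v(\Gamma)=2|V|+2|E|$.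
   Context: Graphs $\Gamma=(V,E)$ are finite, with no loops or multiple edges ($E$ is a set of two-element subsets of $V$). The double graph $D\Gamma$ is the quiver with vertex set $V$ and, for each $\{a,b\}\in E$, two directed edges $(a\,|\,b)$ (from $a$ to $b$) and $(b\,|\,a)$ (from $b$ to $a$). Paths in $D\Gamma$ are written $(a_1\,|\,\dots\,|\,a_n)$ (with $\{a_i,a_{i+1}\}\in E$), of length $n-1$, with $(a)$ the trivial path at $a$. The path algebra $\Bbbk D\Gamma$ has the paths as basis and multiplication by concatenation (zero if the end of the first is not the start of the second). A collection of skew-zigzag coefficients is a family $v=(v^a_{b,c}\in\Bbbk : \{a,b\},\{a,c\}\in E)$ with $v^a_{b,b}=1$, $v^a_{b,c}v^a_{c,b}=1$, and $v^a_{b,c}v^a_{c,d}v^a_{d,b}=1$ whenever the vertices $b,c,d$ involved are all adjacent to $a$. The skew-zigzag algebra $A_v(\Gamma)$ is defined as follows. If $|V|=1$: $A_v(\Gamma)$ is the algebra generated by $1$ and $X$ with $X^2=0$. If $|V|=2$: $A_v(\Gamma)$ is the quotient of $\Bbbk D\Gamma$ by the two-sided ideal generated by all paths of length greater than two. If $|V|\ge 3$: $A_v(\Gamma)=\Bbbk D\Gamma/I_v$, where $I_v$ is the two-sided ideal generated by all paths $(a_1\,|\,a_2\,|\,a_3)$ with $a_1\ne a_3$ and all $(a_1\,|\,a_2\,|\,a_1)-v^{a_1}_{a_2,a_3}(a_1\,|\,a_3\,|\,a_1)$ with $a_1$ adjacent to $a_2$ and $a_3$. $[a_1\,|\,\dots\,|\,a_n]$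 denotes the class of the path $(a_1\,|\,\dots\,|\,a_n)$ in $A_v(\Gamma)$. *)

theory Defs
  imports
    "Jordan_Normal_Form.Missing_VectorSpace"
    "HOL-Algebra.QuotRing"
    "Graph_Theory.Graph_Theory"
begin

definition simple_graph :: "'v set \<Rightarrow> 'v set set \<Rightarrow> bool" where
  "simple_graph V E \<longleftrightarrow> finite V \<and> E \<subseteq> {e. e \<subseteq> V \<and> card e = 2}"

definition double_graph :: "'v set \<Rightarrow> 'v set set \<Rightarrow> 'v pair_pre_digraph" where
  "double_graph V E = \<lparr>pverts = V, parcs = {(a, b). {a, b} \<in> E}\<rparr>"


text \<open>
  The path algebra of a quiver \<open>Q\<close> without parallel arrows.  The path \<open>(a\<^sub>1|...|a\<^sub>n)\<close> is the
  list \<open>[a\<^sub>1, ..., a\<^sub>n]\<close>, and an element of the algebra is its finitely supported coefficient function.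
\<close>

definition path_algebra ::
  "('k, 'm) ring_scheme \<Rightarrow> 'v pair_pre_digraph \<Rightarrow> ('k, 'v list \<Rightarrow> 'k) module" where
  "path_algebra K Q =
    \<lparr>carrier = {f. (\<forall>p. f p \<in> carrier K) \<and> finite {p. f p \<noteq> \<zero>\<^bsub>K\<^esub>} \<and>
                   (\<forall>p. f p \<noteq> \<zero>\<^bsub>K\<^esub> \<longrightarrow> vwalk p (with_proj Q))},
     monoid.mult = (\<lambda>f g r. finsum K (\<lambda>(p, q). f p \<otimes>\<^bsub>K\<^esub> g q)
                       {(p, q). joinable p q \<and> vwalk_join p q = r}),
     one = (\<lambda>p. if \<exists>a \<in> pverts Q. p = [a] then \<one>\<^bsub>K\<^esub> else \<zero>\<^bsub>K\<^esub>),
     zero = (\<lambda>p. \<zero>\<^bsub>K\<^esub>),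
     add = (\<lambda>f g p. f p \<oplus>\<^bsub>K\<^esub> g p),
     smult = (\<lambda>c f p. c \<otimes>\<^bsub>K\<^esub> f p)\<rparr>"

definition path_vec :: "('k, 'm) ring_scheme \<Rightarrow> 'v list \<Rightarrow> 'v list \<Rightarrow> 'k" where
  "path_vec K p = (\<lambda>q. if q = p then \<one>\<^bsub>K\<^esub> else \<zero>\<^bsub>K\<^esub>)"

text \<open>The multiplication above is the bilinear extension of the concatenation of paths.\<close>

lemma path_vec_mult:
  fixes p q :: "'v list"
  assumes "ring K" and "p \<noteq> []" and "q \<noteq> []"
  shows "path_vec K p \<otimes>\<^bsub>path_algebra K Q\<^esub> path_vec K q =
    (if last p = hd q then path_vec K (vwalk_join p q) else \<zero>\<^bsub>path_algebra K Q\<^esub>)"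
proof
  fix r :: "'v list"
  interpret ring K by fact
  define S where "S = {(p, q). joinable p q \<and> vwalk_join p q = r}"
  define F where "F = (\<lambda>(p', q'). path_vec K p p' \<otimes>\<^bsub>K\<^esub> path_vec K q q')"
  have "S \<subseteq> (\<lambda>n. (take n r, last (take n r) # drop n r)) ` {..length r}"
  proof
    fix s assume "s \<in> S"
    then obtain a b where s: "s = (a, b)" "joinable a b" "r = a @ tl b"
      by (auto simp: S_def vwalk_join_def)
    then have "b = last a # tl b" by (auto simp: joinable_def)
    with s have "s = (take (length a) r, last (take (length a) r) # drop (length a) r)"
      by simp
    moreover have "length a \<le> length r" using s by simp
    ultimately show "s \<in> (\<lambda>n. (take n r, last (take n r) # drop n r)) ` {..length r}"
      by blast
  qed
  then have fin: "finite S" by (rule finite_subset) simp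
  have F: "F s = (if (p, q) = s then \<one>\<^bsub>K\<^esub> else \<zero>\<^bsub>K\<^esub>)" for s
    by (cases s) (auto simp: F_def path_vec_def)
  have "finsum K F S = finsum K (\<lambda>s. if (p, q) = s then \<one>\<^bsub>K\<^esub> else \<zero>\<^bsub>K\<^esub>) S"
    by (rule finsum_cong') (auto simp: F)
  also have "\<dots> = (if (p, q) \<in> S then \<one>\<^bsub>K\<^esub> else \<zero>\<^bsub>K\<^esub>)"
  proof (cases "(p, q) \<in> S")
    case True
    then show ?thesis using finsum_singleton[OF True fin, of "\<lambda>_. \<one>\<^bsub>K\<^esub>"] by simp
  next
    case False
    then have "finsum K (\<lambda>s. if (p, q) = s then \<one>\<^bsub>K\<^esub> else \<zero>\<^bsub>K\<^esub>) S = finsum K (\<lambda>s. \<zero>\<^bsub>K\<^esub>) S"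
      by (intro finsum_cong') auto
    then show ?thesis using False by simp
  qed
  finally have "finsum K F S = (if (p, q) \<in> S then \<one>\<^bsub>K\<^esub> else \<zero>\<^bsub>K\<^esub>)" .
  then show "(path_vec K p \<otimes>\<^bsub>path_algebra K Q\<^esub> path_vec K q) r =
    (if last p = hd q then path_vec K (vwalk_join p q) else \<zero>\<^bsub>path_algebra K Q\<^esub>) r"
    using assms by (auto simp: path_algebra_def F_def S_def path_vec_def joinable_def)
qed


text \<open>The quotient ring by a two-sided ideal, with the induced scalar multiplication.\<close>

definition quot_algebra :: "('k, 'a, 'n) module_scheme \<Rightarrow> 'a set \<Rightarrow> ('k, 'a set) module" where
  "quot_algebra A I =
    ring.extend (A Quot I) (module.fields (\<lambda>c X. \<Union>x\<in>X. I +>\<^bsub>A\<^esub> (c \<odot>\<^bsub>A\<^esub> x)))"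


text \<open>The coefficient \<open>v\<^sup>a\<^bsub>b,c\<^esub>\<close> is written \<open>v a b c\<close>.\<close>

definition skew_zigzag_coeffs ::
  "('k, 'm) ring_scheme \<Rightarrow> 'v set set \<Rightarrow> ('v \<Rightarrow> 'v \<Rightarrow> 'v \<Rightarrow> 'k) \<Rightarrow> bool" where
  "skew_zigzag_coeffs K E v \<longleftrightarrow>
    (\<forall>a b c. {a, b} \<in> E \<and> {a, c} \<in> E \<longrightarrow> v a b c \<in> carrier K) \<and>
    (\<forall>a b. {a, b} \<in> E \<longrightarrow> v a b b = \<one>\<^bsub>K\<^esub>) \<and>
    (\<forall>a b c. {a, b} \<in> E \<and> {a, c} \<in> E \<longrightarrow> v a b c \<otimes>\<^bsub>K\<^esub> v a c b = \<one>\<^bsub>K\<^esub>) \<and>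
    (\<forall>a b c d. {a, b} \<in> E \<and> {a, c} \<in> E \<and> {a, d} \<in> E \<longrightarrow>
      v a b c \<otimes>\<^bsub>K\<^esub> v a c d \<otimes>\<^bsub>K\<^esub> v a d b = \<one>\<^bsub>K\<^esub>)"

text \<open>
  For \<open>V = {x}\<close> the algebra generated by \<open>1\<close> and \<open>X\<close> with \<open>X\<^sup>2 = 0\<close> is obtained as a quotient of
  the path algebra of the quiver with the single vertex \<open>x\<close> and a single loop \<open>(x|x)\<close>: its paths
  are the powers of the loop, so that this path algebra is the polynomial algebra in
  \<open>X = (x|x)\<close>, with \<open>1 = (x)\<close> and \<open>X\<^sup>2 = (x|x|x)\<close>.  Thus all skew-zigzag algebras over a
  given vertex type have the same type.
\<close>

definition skew_zigzag_quiver :: "'v set \<Rightarrow> 'v set set \<Rightarrow> 'v pair_pre_digraph" where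
  "skew_zigzag_quiver V E =
    (if card V = 1 then \<lparr>pverts = V, parcs = V \<times> V\<rparr> else double_graph V E)"

definition skew_zigzag_relations ::
  "('k, 'm) ring_scheme \<Rightarrow> 'v set \<Rightarrow> 'v set set \<Rightarrow> ('v \<Rightarrow> 'v \<Rightarrow> 'v \<Rightarrow> 'k) \<Rightarrow> ('v list \<Rightarrow> 'k) set"
  where
  "skew_zigzag_relations K V E v =
    (let P = path_algebra K (skew_zigzag_quiver V E) in
     if card V = 1 then {path_vec K [x, x] \<otimes>\<^bsub>P\<^esub> path_vec K [x, x] | x. x \<in> V}
     else if card V = 2 then
       {path_vec K p | p. vwalk p (with_proj (double_graph V E)) \<and> vwalk_length p > 2}
     else
       {path_vec K [a\<^sub>1, a\<^sub>2, a\<^sub>3] | a\<^sub>1 a\<^sub>2 a\<^sub>3. {a\<^sub>1, a\<^sub>2} \<in> E \<and> {a\<^sub>2, a\<^sub>3} \<in> E \<and> a\<^sub>1 \<noteq> a\<^sub>3} \<union>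
       {path_vec K [a\<^sub>1, a\<^sub>2, a\<^sub>1] \<ominus>\<^bsub>P\<^esub> v a\<^sub>1 a\<^sub>2 a\<^sub>3 \<odot>\<^bsub>P\<^esub> path_vec K [a\<^sub>1, a\<^sub>3, a\<^sub>1] | a\<^sub>1 a\<^sub>2 a\<^sub>3.
          {a\<^sub>1, a\<^sub>2} \<in> E \<and> {a\<^sub>1, a\<^sub>3} \<in> E})"

definition skew_zigzag_ideal ::
  "('k, 'm) ring_scheme \<Rightarrow> 'v set \<Rightarrow> 'v set set \<Rightarrow> ('v \<Rightarrow> 'v \<Rightarrow> 'v \<Rightarrow> 'k) \<Rightarrow> ('v list \<Rightarrow> 'k) set"
  where
  "skew_zigzag_ideal K V E v =
    Idl\<^bsub>path_algebra K (skew_zigzag_quiver V E)\<^esub> (skew_zigzag_relations K V E v)"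

definition skew_zigzag_algebra ::
  "('k, 'm) ring_scheme \<Rightarrow> 'v set \<Rightarrow> 'v set set \<Rightarrow> ('v \<Rightarrow> 'v \<Rightarrow> 'v \<Rightarrow> 'k) \<Rightarrow>
    ('k, ('v list \<Rightarrow> 'k) set) module" where
  "skew_zigzag_algebra K V E v =
    quot_algebra (path_algebra K (skew_zigzag_quiver V E)) (skew_zigzag_ideal K V E v)"

definition path_class ::
  "('k, 'm) ring_scheme \<Rightarrow> 'v set \<Rightarrow> 'v set set \<Rightarrow> ('v \<Rightarrow> 'v \<Rightarrow> 'v \<Rightarrow> 'k) \<Rightarrow> 'v list \<Rightarrow>
    ('v list \<Rightarrow> 'k) set" where
  "path_class K V E v p =
    skew_zigzag_ideal K V E v +>\<^bsub>path_algebra K (skew_zigzag_quiver V E)\<^esub> path_vec K p"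

end

theory Submission
  imports Defs
begin

text \<open>
  Both bounds on \<open>A\<^sub>v(\<Gamma>)\<close> are proved inside the path algebra, without a normal form for the elements
  of the ideal of relations.

  \<^item> Spanning.  Suppose that there are at least three vertices.  A path of length two is either
    killed (different ends) or a multiple of the chosen cycle \<open>(x|y\<^sub>x|x)\<close> at its starting point.
    Every path of length three vanishes: if it is not of the form \<open>(a|b|a|b)\<close>, one of its two
    subpaths of length two has different ends; otherwise connectedness gives \<open>a\<close> or \<open>b\<close> another
    neighbour \<open>c\<close>, and replacing the cycle \<open>(a|b|a)\<close> by a multiple of \<open>(a|c|a)\<close>, or \<open>(b|a|b)\<close> by a
    multiple of \<open>(b|c|b)\<close>, produces such a subpath (\<open>path_of_length_three_in_I\<close>).
    Longer paths contain one of length three.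

  \<^item> Independence.  The coefficients at paths of length at most one, together with the functionals
    \<open>f \<mapsto> \<Sum>\<^sub>z v\<^sup>x\<^bsub>z,y\<^esub> f(x|z|x)\<close> with \<open>y = y\<^sub>x\<close>, are dual to the proposed basis.  Their
    common kernel is a two-sided ideal, since in the lowest degree multiplication only scales the
    coefficients of closed paths at \<open>x\<close> by a common factor (\<open>ideal_cutoff_ideal\<close>), and it contains
    the relations because \<open>v\<^sup>x\<^bsub>a,b\<^esub> v\<^sup>x\<^bsub>b,y\<^esub> = v\<^sup>x\<^bsub>a,y\<^esub>\<close> (\<open>coeffs_chain\<close>).  So the functionals
    descend to the quotient.

  For one and two vertices the ideal of relations is spanned by all paths beyond a fixed length, and
  the same criterion \<open>quotient_basis\<close> applies with plain coefficient functionals.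
\<close>

no_notation vwalk_join (infixr "\<oplus>" 65)

section \<open>The path algebra as a ring and a module\<close>

text \<open>
  Splitting off the first vertex of a path turns the convolution product into a structural
  recursion; the algebra laws then become inductions over the path in place of manipulations of
  double sums over decompositions.
\<close>

fun path_conv :: "('k, 'm) ring_scheme \<Rightarrow> ('v list \<Rightarrow> 'k) \<Rightarrow> ('v list \<Rightarrow> 'k) \<Rightarrow> 'v list \<Rightarrow> 'k" where
  "path_conv K f g [] = \<zero>\<^bsub>K\<^esub>"
| "path_conv K f g (a # r) =
     f [a] \<otimes>\<^bsub>K\<^esub> g (a # r) \<oplus>\<^bsub>K\<^esub> path_conv K (\<lambda>p. f (a # p)) g r"

lemma path_splittings_Cons:
  "{(p, q). joinable p q \<and> vwalk_join p q = a # r} =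
   insert ([a], a # r) ((\<lambda>(p, q). (a # p, q)) ` {(p, q). joinable p q \<and> vwalk_join p q = r})"
  (is "?L = insert ?s (?h ` ?S)")
proof
  show "?L \<subseteq> insert ?s (?h ` ?S)"
  proof
    fix x assume "x \<in> ?L"
    then obtain p q where x: "x = (p, q)" "joinable p q" "p @ tl q = a # r"
      by (auto simp: vwalk_join_def)
    then obtain p' where p: "p = a # p'" by (cases p) auto
    show "x \<in> insert ?s (?h ` ?S)"
    proof (cases "p' = []")
      case True
      then show ?thesis using x p by (cases q) (auto simp: joinable_def)
    next
      case False
      then have "(p', q) \<in> ?S" using x p by (auto simp: vwalk_join_def joinable_def)
      then have "?h (p', q) \<in> ?h ` ?S" by (rule imageI)
      then show ?thesis using x p by simp
    qed
  qed
  show "insert ?s (?h ` ?S) \<subseteq> ?L"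
    by (auto simp: joinable_def vwalk_join_def)
qed

lemma path_splittings_Nil: "{(p, q). joinable p q \<and> vwalk_join p q = []} = {}"
  by (auto simp: joinable_def vwalk_join_def)

lemma finite_path_splittings: "finite {(p, q). joinable p q \<and> vwalk_join p q = r}"
  by (induction r) (simp_all only: path_splittings_Nil path_splittings_Cons
      finite_insert finite_imageI finite.emptyI)

context cring
begin

lemma path_conv_closed [intro, simp]:
  "\<lbrakk>\<And>p. f p \<in> carrier R; \<And>p. g p \<in> carrier R\<rbrakk> \<Longrightarrow> path_conv R f g r \<in> carrier R"
  by (induction r arbitrary: f) auto

lemma finsum_splittings_eq_path_conv:
  fixes f g :: "'v list \<Rightarrow> 'a"
  assumes "\<And>p. f p \<in> carrier R" "\<And>p. g p \<in> carrier R"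
  shows "(\<Oplus>s\<in>{(p, q). joinable p q \<and> vwalk_join p q = r}. case s of (p, q) \<Rightarrow> f p \<otimes> g q) = path_conv R f g r"
  using assms(1)
proof (induction r arbitrary: f)
  case Nil
  then show ?case by (simp only: path_splittings_Nil finsum_empty path_conv.simps)
next
  case (Cons a r)
  let ?S = "{(p, q). joinable p q \<and> vwalk_join p q = r}"
  let ?h = "\<lambda>(p :: 'v list, q :: 'v list). (a # p, q)"
  have notin: "([a], a # r) \<notin> ?h ` ?S" by (auto simp: joinable_def)
  have inj: "inj_on ?h ?S" by (auto simp: inj_on_def)
  have fin: "finite ?S" by (rule finite_path_splittings)
  have "(\<Oplus>s\<in>insert ([a], a # r) (?h ` ?S). case s of (p, q) \<Rightarrow> f p \<otimes> g q) =
      f [a] \<otimes> g (a # r) \<oplus> (\<Oplus>s\<in>?h ` ?S. case s of (p, q) \<Rightarrow> f p \<otimes> g q)"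
    by (subst finsum_insert[OF finite_imageI[OF fin] notin]) (auto simp: Cons.prems assms(2))
  also have "(\<Oplus>s\<in>?h ` ?S. case s of (p, q) \<Rightarrow> f p \<otimes> g q) = (\<Oplus>s\<in>?S. case ?h s of (p, q) \<Rightarrow> f p \<otimes> g q)"
    by (rule finsum_reindex[OF _ inj]) (auto simp: Cons.prems assms(2))
  also have "\<dots> = (\<Oplus>s\<in>?S. case s of (p, q) \<Rightarrow> f (a # p) \<otimes> g q)"
    by (rule finsum_cong') (auto simp: Cons.prems assms(2))
  also have "\<dots> = path_conv R (\<lambda>p. f (a # p)) g r"
    by (rule Cons.IH) (simp add: Cons.prems)
  finally show ?case by (simp only: path_splittings_Cons path_conv.simps)
qed

lemma path_conv_add_left:
  assumes "\<And>p. f p \<in> carrier R" "\<And>p. g p \<in> carrier R" "\<And>p. h p \<in> carrier R"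
  shows "path_conv R (\<lambda>p. f p \<oplus> g p) h r = path_conv R f h r \<oplus> path_conv R g h r"
  using assms(1,2)
proof (induction r arbitrary: f g)
  case (Cons a r)
  have "path_conv R (\<lambda>p. f (a # p) \<oplus> g (a # p)) h r =
      path_conv R (\<lambda>p. f (a # p)) h r \<oplus> path_conv R (\<lambda>p. g (a # p)) h r"
    by (rule Cons.IH) (auto simp: Cons.prems)
  then show ?case
    by (simp add: Cons.prems assms(3) l_distr a_ac)
qed simp

lemma path_conv_add_right:
  assumes "\<And>p. f p \<in> carrier R" "\<And>p. g p \<in> carrier R" "\<And>p. h p \<in> carrier R"
  shows "path_conv R h (\<lambda>p. f p \<oplus> g p) r = path_conv R h f r \<oplus> path_conv R h g r"
  using assms(3)
proof (induction r arbitrary: h)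
  case (Cons a r)
  have "path_conv R (\<lambda>p. h (a # p)) (\<lambda>p. f p \<oplus> g p) r =
      path_conv R (\<lambda>p. h (a # p)) f r \<oplus> path_conv R (\<lambda>p. h (a # p)) g r"
    by (rule Cons.IH) (auto simp: Cons.prems)
  then show ?case
    by (simp add: Cons.prems assms(1,2) r_distr a_ac)
qed simp

lemma path_conv_smult_left:
  assumes "c \<in> carrier R" "\<And>p. f p \<in> carrier R" "\<And>p. g p \<in> carrier R"
  shows "path_conv R (\<lambda>p. c \<otimes> f p) g r = c \<otimes> path_conv R f g r"
  using assms(2)
proof (induction r arbitrary: f)
  case (Cons a r)
  have "path_conv R (\<lambda>p. c \<otimes> f (a # p)) g r = c \<otimes> path_conv R (\<lambda>p. f (a # p)) g r"
    by (rule Cons.IH) (auto simp: Cons.prems)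
  then show ?case
    by (simp add: Cons.prems assms(1,3) r_distr m_assoc)
qed (simp add: assms)

lemma path_conv_smult_right:
  assumes "c \<in> carrier R" "\<And>p. f p \<in> carrier R" "\<And>p. g p \<in> carrier R"
  shows "path_conv R f (\<lambda>p. c \<otimes> g p) r = c \<otimes> path_conv R f g r"
  using assms(2)
proof (induction r arbitrary: f)
  case (Cons a r)
  have "path_conv R (\<lambda>p. f (a # p)) (\<lambda>p. c \<otimes> g p) r = c \<otimes> path_conv R (\<lambda>p. f (a # p)) g r"
    by (rule Cons.IH) (auto simp: Cons.prems)
  then show ?case
    by (simp add: Cons.prems assms(1,3) r_distr m_lcomm)
qed (simp add: assms)

lemma path_conv_assoc:
  assumes "\<And>p. f p \<in> carrier R" "\<And>p. g p \<in> carrier R" "\<And>p. h p \<in> carrier R"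
  shows "path_conv R (path_conv R f g) h r = path_conv R f (path_conv R g h) r"
  using assms(1,2)
proof (induction r arbitrary: f g)
  case (Cons a r)
  let ?f = "\<lambda>p. f (a # p)" and ?g = "\<lambda>p. g (a # p)"
  have "path_conv R (\<lambda>p. path_conv R f g (a # p)) h r =
      f [a] \<otimes> path_conv R ?g h r \<oplus> path_conv R (path_conv R ?f g) h r"
    by (simp add: path_conv_add_left path_conv_smult_left Cons.prems assms(3))
  also have "path_conv R (path_conv R ?f g) h r = path_conv R ?f (path_conv R g h) r"
    by (rule Cons.IH) (auto simp: Cons.prems)
  finally show ?case
    by (simp add: Cons.prems assms(3) r_distr m_assoc a_assoc)
qed simp

lemma path_conv_nonzeroE:
  assumes "path_conv R f g r \<noteq> \<zero>" "\<And>p. f p \<in> carrier R" "\<And>p. g p \<in> carrier R"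
  obtains p q where "joinable p q" "r = vwalk_join p q" "f p \<noteq> \<zero>" "g q \<noteq> \<zero>"
proof -
  have "\<exists>p q. joinable p q \<and> r = vwalk_join p q \<and> f p \<noteq> \<zero> \<and> g q \<noteq> \<zero>"
    using assms(1,2)
  proof (induction r arbitrary: f)
    case (Cons a r)
    show ?case
    proof (cases "f [a] \<otimes> g (a # r) = \<zero>")
      case True
      then have "path_conv R (\<lambda>p. f (a # p)) g r \<noteq> \<zero>"
        using Cons.prems assms(3) by auto
      from Cons.IH[OF this] obtain p q where
        "joinable p q" "r = vwalk_join p q" "f (a # p) \<noteq> \<zero>" "g q \<noteq> \<zero>"
        using Cons.prems by blast
      then show ?thesis
        by (intro exI[of _ "a # p"] exI[of _ q]) (auto simp: joinable_def)
    next
      case False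
      then have "f [a] \<noteq> \<zero>" "g (a # r) \<noteq> \<zero>"
        using Cons.prems assms(3) by auto
      then show ?thesis
        by (intro exI[of _ "[a]"] exI[of _ "a # r"]) (auto simp: joinable_def vwalk_join_def)
    qed
  qed simp
  then show thesis using that by blast
qed

text \<open>
  The next two lemmas describe products with an element supported in high degrees: in its lowest
  degree only the trivial path at one end of the other factor contributes.
\<close>

lemma path_conv_lowest_left:
  assumes "\<And>p. f p \<in> carrier R" "\<And>p. g p \<in> carrier R"
    and "\<And>p. length p \<le> n \<Longrightarrow> f p = \<zero>" "length r \<le> Suc n" "r \<noteq> []"
  shows "path_conv R f g r = f r \<otimes> g [last r]"
  using assms(1,3-)
proof (induction r arbitrary: f n)
  case (Cons a r)
  show ?case
  proof (cases r)
    case Nil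
    then show ?thesis using Cons.prems(1) assms(2) by simp
  next
    case (Cons b s)
    then obtain m where n: "n = Suc m" using Cons.prems(3) by (cases n) auto
    have "path_conv R (\<lambda>p. f (a # p)) g r = f (a # r) \<otimes> g [last r]"
      using Cons.prems n Cons by (intro Cons.IH[of _ m]) auto
    moreover have "f [a] = \<zero>" using Cons.prems(2)[of "[a]"] n by simp
    ultimately show ?thesis using Cons.prems(1) assms(2) Cons by simp
  qed
qed simp

lemma path_conv_lowest_right:
  assumes "\<And>p. f p \<in> carrier R" "\<And>p. g p \<in> carrier R"
    and "\<And>p. length p \<le> n \<Longrightarrow> f p = \<zero>" "length r \<le> Suc n" "r \<noteq> []"
  shows "path_conv R g f r = g [hd r] \<otimes> f r"
proof -
  have zero: "path_conv R g f s = \<zero>" if "length s \<le> n" "\<And>p. g p \<in> carrier R" for g s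
    using that
  proof (induction s arbitrary: g)
    case (Cons a s)
    have "path_conv R (\<lambda>p. g (a # p)) f s = \<zero>"
      using Cons.prems by (intro Cons.IH) auto
    then show ?case using Cons.prems assms(3)[of "a # s"] by simp
  qed simp
  obtain a s where r: "r = a # s" using assms(5) by (cases r) auto
  have "path_conv R (\<lambda>p. g (a # p)) f s = \<zero>"
    using assms(2,4) r by (intro zero) auto
  then show ?thesis using assms r by simp
qed

end


text \<open>Finitely many vertices are needed for the sum of the trivial paths to be a unit.\<close>

locale field_path_algebra = K?: field K
  for K :: "('k, 'm) ring_scheme" (structure) +
  fixes Q :: "'v pair_pre_digraph"
  assumes finite_verts: "finite (pverts Q)"
begin

abbreviation P where "P \<equiv> path_algebra K Q"

lemma path_algebra_simps:
  "\<zero>\<^bsub>P\<^esub> = (\<lambda>p. \<zero>)" "f \<oplus>\<^bsub>P\<^esub> g = (\<lambda>p. f p \<oplus> g p)" "c \<odot>\<^bsub>P\<^esub> f = (\<lambda>p. c \<otimes> f p)"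
  "\<one>\<^bsub>P\<^esub> = (\<lambda>p. if \<exists>a\<in>pverts Q. p = [a] then \<one> else \<zero>)"
  by (simp_all add: path_algebra_def)

lemma path_algebra_carrier_iff:
  "f \<in> carrier P \<longleftrightarrow> (\<forall>p. f p \<in> carrier K) \<and> finite {p. f p \<noteq> \<zero>} \<and>
     (\<forall>p. f p \<noteq> \<zero> \<longrightarrow> vwalk p (with_proj Q))"
  by (simp add: path_algebra_def)

lemma coeff_closed: "f \<in> carrier P \<Longrightarrow> f p \<in> carrier K"
  by (simp add: path_algebra_carrier_iff)

lemma path_algebra_mult:
  assumes "f \<in> carrier P" "g \<in> carrier P"
  shows "f \<otimes>\<^bsub>P\<^esub> g = path_conv K f g"
proof
  fix r
  show "(f \<otimes>\<^bsub>P\<^esub> g) r = path_conv K f g r"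
    using finsum_splittings_eq_path_conv[of f g r] coeff_closed[OF assms(1)] coeff_closed[OF assms(2)]
    by (simp add: path_algebra_def)
qed

lemma path_algebra_carrierI:
  assumes "\<And>p. f p \<in> carrier K" "finite S" "\<And>p. f p \<noteq> \<zero> \<Longrightarrow> p \<in> S \<and> vwalk p (with_proj Q)"
  shows "f \<in> carrier P"
  using assms finite_subset[of "{p. f p \<noteq> \<zero>}" S] by (auto simp: path_algebra_carrier_iff)

lemma path_vec_closed [intro, simp]: "vwalk p (with_proj Q) \<Longrightarrow> path_vec K p \<in> carrier P"
  by (rule path_algebra_carrierI[of _ "{p}"]) (auto simp: path_vec_def split: if_splits)

lemma path_algebra_mult_closed:
  assumes f: "f \<in> carrier P" and g: "g \<in> carrier P"
  shows "f \<otimes>\<^bsub>P\<^esub> g \<in> carrier P"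
proof (rule path_algebra_carrierI)
  let ?S = "(\<lambda>(p, q). vwalk_join p q) ` ({p. f p \<noteq> \<zero>} \<times> {q. g q \<noteq> \<zero>})"
  show "finite ?S" using f g by (auto simp: path_algebra_carrier_iff)
  show "(f \<otimes>\<^bsub>P\<^esub> g) r \<in> carrier K" for r
    using f g by (simp add: path_algebra_mult coeff_closed)
  show "r \<in> ?S \<and> vwalk r (with_proj Q)" if "(f \<otimes>\<^bsub>P\<^esub> g) r \<noteq> \<zero>" for r
  proof -
    have "path_conv K f g r \<noteq> \<zero>" using that by (simp add: path_algebra_mult[OF f g])
    from path_conv_nonzeroE[OF this coeff_closed[OF f] coeff_closed[OF g]]
    obtain p q where pq: "joinable p q" "r = vwalk_join p q" "f p \<noteq> \<zero>" "g q \<noteq> \<zero>" .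
    then have "vwalk r (with_proj Q)"
      using f g vwalk_joinI_vwalk[of p "with_proj Q" q] unfolding path_algebra_carrier_iff
      by blast
    then show ?thesis using pq by auto
  qed
qed

lemma path_algebra_one_mult:
  assumes f: "f \<in> carrier P"
  shows "path_conv K \<one>\<^bsub>P\<^esub> f = f" "path_conv K f \<one>\<^bsub>P\<^esub> = f"
proof -
  note [simp] = coeff_closed[OF f]
  have walk: "r \<noteq> [] \<and> set r \<subseteq> pverts Q" if "f r \<noteq> \<zero>" for r
    using f that by (auto simp: path_algebra_carrier_iff vwalk_def)
  have zero: "path_conv K (\<lambda>p. \<zero>) f s = \<zero>" for s
    using f by (induction s) auto
  show "path_conv K \<one>\<^bsub>P\<^esub> f = f"
  proof
    fix r
    show "path_conv K \<one>\<^bsub>P\<^esub> f r = f r"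
    proof (cases r)
      case Nil
      then show ?thesis using walk[of r] by (cases "f r = \<zero>") simp_all
    next
      case (Cons a s)
      have "path_conv K (\<lambda>p. \<one>\<^bsub>P\<^esub> (a # p)) f s = \<zero>"
      proof (cases s)
        case (Cons b t)
        have tail: "(\<lambda>p. \<one>\<^bsub>P\<^esub> (a # b # p)) = (\<lambda>p. \<zero>)" by (auto simp: path_algebra_simps)
        show ?thesis using f by (simp add: Cons tail zero) (simp add: path_algebra_simps)
      qed simp
      moreover have "f r = \<zero>" if "a \<notin> pverts Q"
        using walk[of r] Cons that by auto
      ultimately show ?thesis
        using Cons by (auto simp: path_algebra_simps)
    qed
  qed
  have right: "path_conv K g \<one>\<^bsub>P\<^esub> r = g r"
    if "\<And>p. g p \<in> carrier K" "r \<noteq> [] \<Longrightarrow> g r \<noteq> \<zero> \<Longrightarrow> last r \<in> pverts Q" "r \<noteq> []" for g r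
    using that
  proof (induction r arbitrary: g)
    case (Cons a s)
    show ?case
    proof (cases "s = []")
      case True
      then show ?thesis using Cons.prems
        by (cases "g [a] = \<zero>") (auto simp: path_algebra_simps)
    next
      case False
      have "path_conv K (\<lambda>p. g (a # p)) \<one>\<^bsub>P\<^esub> s = g (a # s)"
        using Cons.prems False by (intro Cons.IH) auto
      then show ?thesis using Cons.prems False by (simp add: path_algebra_simps)
    qed
  qed simp
  show "path_conv K f \<one>\<^bsub>P\<^esub> = f"
  proof
    fix r
    show "path_conv K f \<one>\<^bsub>P\<^esub> r = f r"
    proof (cases "r = []")
      case True
      then show ?thesis using walk[of r] by (cases "f r = \<zero>") simp_all
    next
      case False
      then show ?thesis using f walk[of r] by (intro right) auto
    qed
  qed
qed

lemma path_algebra_add_closed: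
  assumes "f \<in> carrier P" "g \<in> carrier P"
  shows "f \<oplus>\<^bsub>P\<^esub> g \<in> carrier P"
proof (rule path_algebra_carrierI)
  show "finite ({p. f p \<noteq> \<zero>} \<union> {p. g p \<noteq> \<zero>})"
    using assms by (simp add: path_algebra_carrier_iff)
  note [simp] = coeff_closed[OF assms(1)] coeff_closed[OF assms(2)]
  fix p
  show "(f \<oplus>\<^bsub>P\<^esub> g) p \<in> carrier K" using assms by (simp add: path_algebra_simps)
  assume "(f \<oplus>\<^bsub>P\<^esub> g) p \<noteq> \<zero>"
  then have "f p \<noteq> \<zero> \<or> g p \<noteq> \<zero>" using assms by (auto simp: path_algebra_simps)
  then show "p \<in> {p. f p \<noteq> \<zero>} \<union> {p. g p \<noteq> \<zero>} \<and> vwalk p (with_proj Q)"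
    using assms by (auto simp: path_algebra_carrier_iff)
qed

lemma path_algebra_smult_closed:
  assumes "c \<in> carrier K" "f \<in> carrier P"
  shows "c \<odot>\<^bsub>P\<^esub> f \<in> carrier P"
proof (rule path_algebra_carrierI)
  show "finite {p. f p \<noteq> \<zero>}" using assms by (simp add: path_algebra_carrier_iff)
  note [simp] = assms(1) coeff_closed[OF assms(2)]
  fix p
  show "(c \<odot>\<^bsub>P\<^esub> f) p \<in> carrier K" using assms by (simp add: path_algebra_simps)
  assume "(c \<odot>\<^bsub>P\<^esub> f) p \<noteq> \<zero>"
  then have "f p \<noteq> \<zero>" using assms by (auto simp: path_algebra_simps)
  then show "p \<in> {p. f p \<noteq> \<zero>} \<and> vwalk p (with_proj Q)"
    using assms by (auto simp: path_algebra_carrier_iff)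
qed

lemma module_path_algebra: "Module.module K P"
proof (rule Module.moduleI)
  show "cring K" by (rule is_cring)
  show "abelian_group P"
  proof (rule abelian_groupI)
    fix f assume f: "f \<in> carrier P"
    have "(\<ominus> \<one>) \<odot>\<^bsub>P\<^esub> f \<in> carrier P" using f by (intro path_algebra_smult_closed) auto
    moreover have "((\<ominus> \<one>) \<odot>\<^bsub>P\<^esub> f) \<oplus>\<^bsub>P\<^esub> f = \<zero>\<^bsub>P\<^esub>"
      using f by (simp add: coeff_closed path_algebra_simps l_minus l_neg)
    ultimately show "\<exists>g\<in>carrier P. g \<oplus>\<^bsub>P\<^esub> f = \<zero>\<^bsub>P\<^esub>" by blast
  next
    show "\<zero>\<^bsub>P\<^esub> \<in> carrier P" by (simp add: path_algebra_carrier_iff path_algebra_simps)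
  next
    fix f g assume "f \<in> carrier P" "g \<in> carrier P"
    then show "f \<oplus>\<^bsub>P\<^esub> g = g \<oplus>\<^bsub>P\<^esub> f"
      by (simp add: coeff_closed path_algebra_simps a_comm)
  next
    fix f g h assume "f \<in> carrier P" "g \<in> carrier P" "h \<in> carrier P"
    then show "f \<oplus>\<^bsub>P\<^esub> g \<oplus>\<^bsub>P\<^esub> h = f \<oplus>\<^bsub>P\<^esub> (g \<oplus>\<^bsub>P\<^esub> h)"
      by (simp add: coeff_closed path_algebra_simps a_assoc)
  next
    fix f assume "f \<in> carrier P"
    then show "\<zero>\<^bsub>P\<^esub> \<oplus>\<^bsub>P\<^esub> f = f"
      by (simp add: coeff_closed path_algebra_simps)
  qed (rule path_algebra_add_closed)
next
  fix c d f g assume "c \<in> carrier K" "d \<in> carrier K" "f \<in> carrier P" "g \<in> carrier P"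
  then show "(c \<oplus> d) \<odot>\<^bsub>P\<^esub> f = (c \<odot>\<^bsub>P\<^esub> f) \<oplus>\<^bsub>P\<^esub> (d \<odot>\<^bsub>P\<^esub> f)"
    "c \<odot>\<^bsub>P\<^esub> (f \<oplus>\<^bsub>P\<^esub> g) = (c \<odot>\<^bsub>P\<^esub> f) \<oplus>\<^bsub>P\<^esub> (c \<odot>\<^bsub>P\<^esub> g)"
    "(c \<otimes> d) \<odot>\<^bsub>P\<^esub> f = c \<odot>\<^bsub>P\<^esub> (d \<odot>\<^bsub>P\<^esub> f)"
    by (simp_all add: coeff_closed path_algebra_simps l_distr r_distr m_assoc)
next
  fix f assume "f \<in> carrier P"
  then show "\<one> \<odot>\<^bsub>P\<^esub> f = f" by (simp add: coeff_closed path_algebra_simps)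
qed (rule path_algebra_smult_closed)

lemma path_conv_in_path_algebra:
  "\<lbrakk>f \<in> carrier P; g \<in> carrier P\<rbrakk> \<Longrightarrow> path_conv K f g \<in> carrier P"
  using path_algebra_mult_closed[of f g] by (simp add: path_algebra_mult)

lemma path_algebra_assoc:
  assumes "f \<in> carrier P" "g \<in> carrier P" "h \<in> carrier P"
  shows "f \<otimes>\<^bsub>P\<^esub> g \<otimes>\<^bsub>P\<^esub> h = f \<otimes>\<^bsub>P\<^esub> (g \<otimes>\<^bsub>P\<^esub> h)"
proof
  fix r
  show "(f \<otimes>\<^bsub>P\<^esub> g \<otimes>\<^bsub>P\<^esub> h) r = (f \<otimes>\<^bsub>P\<^esub> (g \<otimes>\<^bsub>P\<^esub> h)) r"
    using assms by (simp add: coeff_closed path_algebra_mult path_conv_in_path_algebra path_conv_assoc)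
qed

lemma path_algebra_distr:
  assumes "f \<in> carrier P" "g \<in> carrier P" "h \<in> carrier P"
  shows "(f \<oplus>\<^bsub>P\<^esub> g) \<otimes>\<^bsub>P\<^esub> h = f \<otimes>\<^bsub>P\<^esub> h \<oplus>\<^bsub>P\<^esub> g \<otimes>\<^bsub>P\<^esub> h"
    and "h \<otimes>\<^bsub>P\<^esub> (f \<oplus>\<^bsub>P\<^esub> g) = h \<otimes>\<^bsub>P\<^esub> f \<oplus>\<^bsub>P\<^esub> h \<otimes>\<^bsub>P\<^esub> g"
proof -
  have mult: "(f \<oplus>\<^bsub>P\<^esub> g) \<otimes>\<^bsub>P\<^esub> h = path_conv K (\<lambda>p. f p \<oplus> g p) h"
    "h \<otimes>\<^bsub>P\<^esub> (f \<oplus>\<^bsub>P\<^esub> g) = path_conv K h (\<lambda>p. f p \<oplus> g p)"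
    using assms path_algebra_add_closed[of f g]
    by (simp_all add: path_algebra_mult) (simp_all add: path_algebra_simps)
  show "(f \<oplus>\<^bsub>P\<^esub> g) \<otimes>\<^bsub>P\<^esub> h = f \<otimes>\<^bsub>P\<^esub> h \<oplus>\<^bsub>P\<^esub> g \<otimes>\<^bsub>P\<^esub> h"
    unfolding mult using assms
    by (simp add: coeff_closed path_algebra_mult path_algebra_simps path_conv_add_left fun_eq_iff)
  show "h \<otimes>\<^bsub>P\<^esub> (f \<oplus>\<^bsub>P\<^esub> g) = h \<otimes>\<^bsub>P\<^esub> f \<oplus>\<^bsub>P\<^esub> h \<otimes>\<^bsub>P\<^esub> g"
    unfolding mult using assms
    by (simp add: coeff_closed path_algebra_mult path_algebra_simps path_conv_add_right fun_eq_iff)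
qed

lemma path_algebra_smult_mult:
  assumes "c \<in> carrier K" "f \<in> carrier P" "g \<in> carrier P"
  shows "(c \<odot>\<^bsub>P\<^esub> f) \<otimes>\<^bsub>P\<^esub> g = c \<odot>\<^bsub>P\<^esub> (f \<otimes>\<^bsub>P\<^esub> g)"
    and "f \<otimes>\<^bsub>P\<^esub> (c \<odot>\<^bsub>P\<^esub> g) = c \<odot>\<^bsub>P\<^esub> (f \<otimes>\<^bsub>P\<^esub> g)"
proof -
  have mult: "(c \<odot>\<^bsub>P\<^esub> f) \<otimes>\<^bsub>P\<^esub> g = path_conv K (\<lambda>p. c \<otimes> f p) g"
    "f \<otimes>\<^bsub>P\<^esub> (c \<odot>\<^bsub>P\<^esub> g) = path_conv K f (\<lambda>p. c \<otimes> g p)"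
    using assms path_algebra_smult_closed[of c f] path_algebra_smult_closed[of c g]
    by (simp_all add: path_algebra_mult) (simp_all add: path_algebra_simps)
  show "(c \<odot>\<^bsub>P\<^esub> f) \<otimes>\<^bsub>P\<^esub> g = c \<odot>\<^bsub>P\<^esub> (f \<otimes>\<^bsub>P\<^esub> g)"
    unfolding mult using assms
    by (simp add: coeff_closed path_algebra_mult path_algebra_simps path_conv_smult_left fun_eq_iff)
  show "f \<otimes>\<^bsub>P\<^esub> (c \<odot>\<^bsub>P\<^esub> g) = c \<odot>\<^bsub>P\<^esub> (f \<otimes>\<^bsub>P\<^esub> g)"
    unfolding mult using assms
    by (simp add: coeff_closed path_algebra_mult path_algebra_simps path_conv_smult_right fun_eq_iff)
qed

lemma ring_path_algebra: "ring P"
proof (rule ringI)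
  show "abelian_group P" by (rule Module.module.axioms(2)[OF module_path_algebra])
  have one: "\<one>\<^bsub>P\<^esub> \<in> carrier P"
    using finite_verts
    by (intro path_algebra_carrierI[of _ "(\<lambda>a. [a]) ` pverts Q"])
       (auto simp: path_algebra_simps vwalk_def split: if_splits)
  show "Group.monoid P"
    by (rule monoidI)
       (simp_all add: one path_algebra_mult_closed path_algebra_assoc,
        simp_all add: one path_algebra_mult path_algebra_one_mult)
qed (fact path_algebra_distr)+

sublocale P: ring P by (rule ring_path_algebra)

sublocale PM: Module.module K P by (rule module_path_algebra)

text \<open>Two-sided ideals are subspaces because a scalar multiple is a product with a multiple of \<open>1\<close>.\<close>

lemma smult_in_ideal:
  assumes "ideal I P" "c \<in> carrier K" "f \<in> I"
  shows "c \<odot>\<^bsub>P\<^esub> f \<in> I"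
proof -
  interpret I: ideal I P by fact
  have "c \<odot>\<^bsub>P\<^esub> f = (c \<odot>\<^bsub>P\<^esub> \<one>\<^bsub>P\<^esub>) \<otimes>\<^bsub>P\<^esub> f"
    using assms path_algebra_smult_mult(1)[of c "\<one>\<^bsub>P\<^esub>" f] by (simp add: I.Icarr)
  then show ?thesis using assms by (simp add: I.I_l_closed)
qed

lemma path_vec_mult_path_vec:
  "\<lbrakk>p \<noteq> []; q \<noteq> []; last p = hd q\<rbrakk> \<Longrightarrow>
     path_vec K p \<otimes>\<^bsub>P\<^esub> path_vec K q = path_vec K (p @ tl q)"
  using path_vec_mult[OF ring_axioms, of p q Q] by (simp add: vwalk_join_def)

lemma path_algebra_induct [consumes 1, case_names zero add]:
  assumes "f \<in> carrier P"
    and "T \<zero>\<^bsub>P\<^esub>"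
    and "\<And>c p g. \<lbrakk>c \<in> carrier K; vwalk p (with_proj Q); g \<in> carrier P; T g\<rbrakk>
           \<Longrightarrow> T (c \<odot>\<^bsub>P\<^esub> path_vec K p \<oplus>\<^bsub>P\<^esub> g)"
  shows "T f"
  using assms(1)
proof (induction "card {p. f p \<noteq> \<zero>}" arbitrary: f)
  case 0
  then have "f = \<zero>\<^bsub>P\<^esub>"
    by (auto simp: path_algebra_carrier_iff path_algebra_simps)
  then show ?case using assms(2) by simp
next
  case (Suc n)
  note [simp] = coeff_closed[OF Suc.prems]
  have fin: "finite {p. f p \<noteq> \<zero>}" using Suc.prems by (simp add: path_algebra_carrier_iff)
  have "{p. f p \<noteq> \<zero>} \<noteq> {}" using Suc.hyps(2) by (metis card.empty nat.distinct(1))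
  then obtain p where p: "f p \<noteq> \<zero>" by blast
  define g where "g = f(p := \<zero>)"
  have supp: "{q. g q \<noteq> \<zero>} = {q. f q \<noteq> \<zero>} - {p}" by (auto simp: g_def)
  have g: "g \<in> carrier P"
    using Suc.prems supp by (auto simp: path_algebra_carrier_iff g_def)
  have "T g"
    using Suc.hyps p fin g by (intro Suc.hyps(1)) (auto simp: supp)
  moreover have "vwalk p (with_proj Q)" using Suc.prems p by (simp add: path_algebra_carrier_iff)
  moreover have "f = f p \<odot>\<^bsub>P\<^esub> path_vec K p \<oplus>\<^bsub>P\<^esub> g"
    by (auto simp: fun_eq_iff path_algebra_simps path_vec_def g_def)
  ultimately show ?case using assms(3)[of "f p" p g] g by simp
qed

end


section \<open>Bases of quotients of path algebras\<close>

lemma quot_algebra_simps: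
  "carrier (quot_algebra A I) = a_rcosets\<^bsub>A\<^esub> I"
  "X \<oplus>\<^bsub>quot_algebra A I\<^esub> Y = X <+>\<^bsub>A\<^esub> Y"
  "\<zero>\<^bsub>quot_algebra A I\<^esub> = I"
  "\<one>\<^bsub>quot_algebra A I\<^esub> = I +>\<^bsub>A\<^esub> \<one>\<^bsub>A\<^esub>"
  "c \<odot>\<^bsub>quot_algebra A I\<^esub> X = (\<Union>x\<in>X. I +>\<^bsub>A\<^esub> (c \<odot>\<^bsub>A\<^esub> x))"
  by (simp_all add: quot_algebra_def ring.extend_def module.fields_def FactRing_def)

text \<open>
  The union that defines the scalar multiple of a coset is again a single coset as soon as the
  ideal is stable under scalars.
\<close>

lemma mod_hom_quot_algebra:
  assumes "Module.module K A" "ring A" "ideal I A"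
    and stable: "\<And>c x. \<lbrakk>c \<in> carrier K; x \<in> I\<rbrakk> \<Longrightarrow> c \<odot>\<^bsub>A\<^esub> x \<in> I"
  shows "mod_hom K A (quot_algebra A I) (\<lambda>x. I +>\<^bsub>A\<^esub> x)"
proof -
  interpret A: ring A by fact
  interpret M: Module.module K A by fact
  interpret I: ideal I A by fact
  let ?B = "quot_algebra A I"
  have carrier: "X \<in> carrier ?B \<longleftrightarrow> (\<exists>x\<in>carrier A. X = I +>\<^bsub>A\<^esub> x)" for X
    by (auto simp: quot_algebra_simps A_RCOSETS_def' a_r_coset_def')
  have add: "(I +>\<^bsub>A\<^esub> x) \<oplus>\<^bsub>?B\<^esub> (I +>\<^bsub>A\<^esub> y) = I +>\<^bsub>A\<^esub> (x \<oplus>\<^bsub>A\<^esub> y)"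
    if "x \<in> carrier A" "y \<in> carrier A" for x y
    using that by (simp add: quot_algebra_simps I.a_rcos_sum)
  have smult: "c \<odot>\<^bsub>?B\<^esub> (I +>\<^bsub>A\<^esub> x) = I +>\<^bsub>A\<^esub> (c \<odot>\<^bsub>A\<^esub> x)"
    if c: "c \<in> carrier K" and x: "x \<in> carrier A" for c x
  proof -
    have "I +>\<^bsub>A\<^esub> (c \<odot>\<^bsub>A\<^esub> y) = I +>\<^bsub>A\<^esub> (c \<odot>\<^bsub>A\<^esub> x)" if y: "y \<in> I +>\<^bsub>A\<^esub> x" for y
    proof -
      obtain i where i: "i \<in> I" "y = i \<oplus>\<^bsub>A\<^esub> x" using y by (auto simp: a_r_coset_def')
      then have "c \<odot>\<^bsub>A\<^esub> y = c \<odot>\<^bsub>A\<^esub> i \<oplus>\<^bsub>A\<^esub> c \<odot>\<^bsub>A\<^esub> x"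
        using c x by (simp add: M.smult_r_distr)
      then have "c \<odot>\<^bsub>A\<^esub> y \<in> I +>\<^bsub>A\<^esub> (c \<odot>\<^bsub>A\<^esub> x)"
        using stable[OF c i(1)] by (auto simp: a_r_coset_def')
      then show ?thesis using I.a_repr_independence'[of "c \<odot>\<^bsub>A\<^esub> y"] c x by simp
    qed
    moreover have "x \<in> I +>\<^bsub>A\<^esub> x" using x by (rule I.a_rcos_self)
    ultimately show ?thesis unfolding quot_algebra_simps by blast
  qed
  have zero: "\<zero>\<^bsub>?B\<^esub> = I +>\<^bsub>A\<^esub> \<zero>\<^bsub>A\<^esub>"
    using I.a_subset by (simp add: quot_algebra_simps)
  have "Module.module K ?B"
  proof (rule Module.moduleI)
    show "cring K" by (rule M.R.is_cring)
    show "abelian_group ?B"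
    proof (rule abelian_groupI)
      fix X assume "X \<in> carrier ?B"
      then obtain x where x: "x \<in> carrier A" "X = I +>\<^bsub>A\<^esub> x" using carrier by blast
      then have "(I +>\<^bsub>A\<^esub> (\<ominus>\<^bsub>A\<^esub> x)) \<oplus>\<^bsub>?B\<^esub> X = \<zero>\<^bsub>?B\<^esub>"
        by (simp add: add zero A.l_neg)
      then show "\<exists>Y\<in>carrier ?B. Y \<oplus>\<^bsub>?B\<^esub> X = \<zero>\<^bsub>?B\<^esub>"
        using x carrier by (intro bexI[of _ "I +>\<^bsub>A\<^esub> (\<ominus>\<^bsub>A\<^esub> x)"]) auto
    qed (auto simp: carrier add zero A.a_ac intro: A.a_closed)
  qed (auto simp: carrier add smult M.smult_l_distr M.smult_r_distr M.smult_assoc1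
         intro: M.smult_closed)
  then show ?thesis
    using assms(1)
    by (auto simp: mod_hom_def mod_hom_axioms_def LinearCombinations.module_hom_def add smult carrier)
qed

definition linear_functional ::
  "('k, 'c) ring_scheme \<Rightarrow> ('k, 'a, 'd) module_scheme \<Rightarrow> ('a \<Rightarrow> 'k) \<Rightarrow> bool" where
  "linear_functional K M \<phi> \<longleftrightarrow>
     (\<forall>x\<in>carrier M. \<phi> x \<in> carrier K) \<and>
     (\<forall>x\<in>carrier M. \<forall>y\<in>carrier M. \<phi> (x \<oplus>\<^bsub>M\<^esub> y) = \<phi> x \<oplus>\<^bsub>K\<^esub> \<phi> y) \<and>
     (\<forall>c\<in>carrier K. \<forall>x\<in>carrier M. \<phi> (c \<odot>\<^bsub>M\<^esub> x) = c \<otimes>\<^bsub>K\<^esub> \<phi> x)"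

lemma linear_functionalD:
  assumes "linear_functional K M \<phi>"
  shows "x \<in> carrier M \<Longrightarrow> \<phi> x \<in> carrier K"
    and "\<lbrakk>x \<in> carrier M; y \<in> carrier M\<rbrakk> \<Longrightarrow> \<phi> (x \<oplus>\<^bsub>M\<^esub> y) = \<phi> x \<oplus>\<^bsub>K\<^esub> \<phi> y"
    and "\<lbrakk>c \<in> carrier K; x \<in> carrier M\<rbrakk> \<Longrightarrow> \<phi> (c \<odot>\<^bsub>M\<^esub> x) = c \<otimes>\<^bsub>K\<^esub> \<phi> x"
  using assms unfolding linear_functional_def by auto

context vectorspace
begin

lemma linear_functional_zero:
  assumes "linear_functional K V \<phi>"
  shows "\<phi> \<zero>\<^bsub>V\<^esub> = \<zero>\<^bsub>K\<^esub>"
proof -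
  have "\<phi> (\<zero>\<^bsub>K\<^esub> \<odot>\<^bsub>V\<^esub> \<zero>\<^bsub>V\<^esub>) = \<zero>\<^bsub>K\<^esub> \<otimes>\<^bsub>K\<^esub> \<phi> \<zero>\<^bsub>V\<^esub>"
    by (rule linear_functionalD(3)[OF assms]) auto
  moreover have "\<phi> \<zero>\<^bsub>V\<^esub> \<in> carrier K" by (rule linear_functionalD(1)[OF assms]) auto
  ultimately show ?thesis by simp
qed

lemma linear_functional_lincomb:
  assumes \<phi>: "linear_functional K V \<phi>" and "finite S" "S \<subseteq> carrier V" "a \<in> S \<rightarrow> carrier K"
  shows "\<phi> (lincomb a S) = finsum K (\<lambda>x. a x \<otimes>\<^bsub>K\<^esub> \<phi> x) S"
  using assms(2-4)
proof (induction S)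
  case empty
  then show ?case using linear_functional_zero[OF \<phi>] by (simp add: lincomb_def)
next
  case (insert x S)
  have mem: "x \<in> carrier V" "a x \<in> carrier K" "S \<subseteq> carrier V" "a \<in> S \<rightarrow> carrier K"
    using insert.prems by auto
  have "lincomb a (insert x S) = a x \<odot>\<^bsub>V\<^esub> x \<oplus>\<^bsub>V\<^esub> lincomb a S"
    using lincomb_insert[of S a x] insert.hyps insert.prems mem by auto
  then have "\<phi> (lincomb a (insert x S)) = a x \<otimes>\<^bsub>K\<^esub> \<phi> x \<oplus>\<^bsub>K\<^esub> \<phi> (lincomb a S)"
    using mem lincomb_closed[of S a]
    by (simp add: linear_functionalD(2,3)[OF \<phi>])
  also have "\<dots> = finsum K (\<lambda>x. a x \<otimes>\<^bsub>K\<^esub> \<phi> x) (insert x S)"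
    using insert mem linear_functionalD(1)[OF \<phi>]
    by (subst R.finsum_insert) (auto simp: Pi_iff subset_iff)
  finally show ?case .
qed

text \<open>
  Applying the dual functionals to a vanishing linear combination reads off its coefficients; the
  indexing by \<open>N\<close> also yields that the spanning family has no repetitions.
\<close>

lemma basisI_dual_family:
  assumes fin: "finite N" and closed: "\<And>n. n \<in> N \<Longrightarrow> b n \<in> carrier V"
    and gen: "span (b ` N) = carrier V"
    and lin: "\<And>n. n \<in> N \<Longrightarrow> linear_functional K V (\<psi> n)"
    and dual: "\<And>m n. \<lbrakk>m \<in> N; n \<in> N\<rbrakk> \<Longrightarrow> \<psi> n (b m) = (if m = n then \<one>\<^bsub>K\<^esub> else \<zero>\<^bsub>K\<^esub>)"
  shows "inj_on b N" and "basis (b ` N)"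
proof -
  show inj: "inj_on b N"
  proof (rule inj_onI)
    fix m n assume mn: "m \<in> N" "n \<in> N" "b m = b n"
    then have "(if m = n then \<one>\<^bsub>K\<^esub> else \<zero>\<^bsub>K\<^esub>) = \<psi> n (b n)" by (metis dual)
    then show "m = n" using mn dual[of n n] by (auto split: if_splits)
  qed
  have sub: "b ` N \<subseteq> carrier V" using closed by auto
  have "lin_indpt (b ` N)"
  proof (rule finite_lin_indpt2)
    fix a assume a: "a \<in> b ` N \<rightarrow> carrier K" and zero: "lincomb a (b ` N) = \<zero>\<^bsub>V\<^esub>"
    show "\<forall>v\<in>b ` N. a v = \<zero>\<^bsub>K\<^esub>"
    proof
      fix v assume "v \<in> b ` N"
      then obtain n where n: "n \<in> N" "v = b n" by blast
      have av: "a v \<in> carrier K" using a \<open>v \<in> b ` N\<close> by auto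
      have coord: "a x \<otimes>\<^bsub>K\<^esub> \<psi> n x = (if v = x then a v else \<zero>\<^bsub>K\<^esub>)" if "x \<in> b ` N" for x
        using that a n inj by (auto simp: dual Pi_iff inj_on_def)
      have "\<zero>\<^bsub>K\<^esub> = \<psi> n (lincomb a (b ` N))"
        using linear_functional_zero[OF lin] n zero by simp
      also have "\<dots> = finsum K (\<lambda>x. a x \<otimes>\<^bsub>K\<^esub> \<psi> n x) (b ` N)"
        using n fin sub a by (intro linear_functional_lincomb lin) auto
      also have "\<dots> = finsum K (\<lambda>x. if v = x then a v else \<zero>\<^bsub>K\<^esub>) (b ` N)"
        using coord av by (intro R.finsum_cong') auto
      also have "\<dots> = a v"
        using R.finsum_singleton[OF \<open>v \<in> b ` N\<close>, of "\<lambda>_. a v"] fin av by auto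
      finally show "a v = \<zero>\<^bsub>K\<^esub>" ..
    qed
  qed (use fin sub in auto)
  then show "basis (b ` N)" using gen sub by (simp add: basis_def)
qed

end


text \<open>
  To find a basis of a path algebra modulo relations \<open>R\<close>, two inputs suffice: reductions of every
  path modulo the relations, which bound the quotient from above, and functionals dual to the
  remaining paths which vanish on some ideal \<open>J\<close> containing \<open>R\<close>, which bound it from below.  The
  generated ideal need not be computed.
\<close>

lemma (in field_path_algebra) quotient_basis:
  assumes R: "R \<subseteq> carrier P" and N: "finite N" "\<forall>n\<in>N. vwalk n (with_proj Q)"
    and I: "I = Idl\<^bsub>P\<^esub> R"
    and reduce: "\<forall>p. vwalk p (with_proj Q) \<longrightarrow> p \<in> N \<or> path_vec K p \<in> I \<or>
      (\<exists>n\<in>N. \<exists>c\<in>carrier K. path_vec K p \<ominus>\<^bsub>P\<^esub> c \<odot>\<^bsub>P\<^esub> path_vec K n \<in> I)"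
    and J: "ideal J P" "R \<subseteq> J"
    and lin: "\<forall>n\<in>N. linear_functional K P (\<phi> n)"
    and vanish: "\<forall>n\<in>N. \<forall>f\<in>J. \<phi> n f = \<zero>"
    and dual: "\<forall>n\<in>N. \<forall>m\<in>N. \<phi> n (path_vec K m) = (if m = n then \<one> else \<zero>)"
  shows "vectorspace K (quot_algebra P I)"
    and "inj_on (\<lambda>p. I +>\<^bsub>P\<^esub> path_vec K p) N"
    and "vectorspace.basis K (quot_algebra P I) ((\<lambda>p. I +>\<^bsub>P\<^esub> path_vec K p) ` N)"
proof -
  let ?A = "quot_algebra P I" and ?cls = "\<lambda>f. I +>\<^bsub>P\<^esub> f"
  interpret I: ideal I P unfolding I by (rule P.genideal_ideal[OF R])
  have hom: "mod_hom K P ?A ?cls"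
    by (rule mod_hom_quot_algebra[OF module_path_algebra ring_path_algebra I.is_ideal smult_in_ideal[OF I.is_ideal]])
  then show vs: "vectorspace K ?A"
    by (intro vectorspace.intro field_axioms) (simp add: mod_hom_def)
  interpret V: vectorspace K ?A by (rule vs)
  interpret H: mod_hom K P ?A ?cls by (rule hom)
  have carrier: "X \<in> carrier ?A \<longleftrightarrow> (\<exists>f\<in>carrier P. X = ?cls f)" for X
    by (auto simp: quot_algebra_simps A_RCOSETS_def' a_r_coset_def')
  let ?B = "(\<lambda>p. ?cls (path_vec K p)) ` N"
  have cls_eq: "?cls f = ?cls g" if "f \<ominus>\<^bsub>P\<^esub> g \<in> I" "f \<in> carrier P" "g \<in> carrier P" for f g
    using P.quotient_eq_iff_same_a_r_cos[OF I.is_ideal] that by blast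
  have B: "?B \<subseteq> carrier ?A" using N(2) by auto
  interpret sp: submodule K "V.span ?B" ?A by (rule V.span_is_submodule[OF B])
  have path: "?cls (path_vec K p) \<in> V.span ?B" if p: "vwalk p (with_proj Q)" for p
    using reduce[rule_format, OF p]
  proof (elim disjE bexE)
    assume "p \<in> N"
    then show ?thesis using V.in_own_span[OF B] by auto
  next
    assume "path_vec K p \<in> I"
    then have "?cls (path_vec K p) = \<zero>\<^bsub>?A\<^esub>"
      using P.a_rcos_zero[OF I.is_ideal] by (simp add: quot_algebra_simps)
    then show ?thesis using sp.zero_closed by simp
  next
    fix n c assume n: "n \<in> N" "c \<in> carrier K" "path_vec K p \<ominus>\<^bsub>P\<^esub> c \<odot>\<^bsub>P\<^esub> path_vec K n \<in> I"
    then have "?cls (path_vec K p) = c \<odot>\<^bsub>?A\<^esub> ?cls (path_vec K n)"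
      using cls_eq p N(2) by (auto simp flip: H.f_smult)
    then show ?thesis using V.in_own_span[OF B] n by auto
  qed
  have gen: "V.span ?B = carrier ?A"
  proof
    show "V.span ?B \<subseteq> carrier ?A" by (rule V.span_is_subset2[OF B])
    have "?cls f \<in> V.span ?B" if "f \<in> carrier P" for f
      using that
    proof (induction rule: path_algebra_induct)
      case zero
      then show ?case using sp.zero_closed by simp
    next
      case (add c p g)
      then show ?case using path[of p] sp.m_closed by simp
    qed
    then show "carrier ?A \<subseteq> V.span ?B" using carrier by auto
  qed
  have "I \<subseteq> J" unfolding I by (rule P.genideal_minimal[OF J])
  \<comment> \<open>As \<open>\<phi> n\<close> vanishes on \<open>I\<close>, it is constant on cosets and so descends to the quotient.\<close>
  define \<psi> where "\<psi> n X = the_elem (\<phi> n ` X)" for n X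
  have \<psi>: "\<psi> n (?cls f) = \<phi> n f" if n: "n \<in> N" and f: "f \<in> carrier P" for n f
  proof -
    have "\<phi> n g = \<phi> n f" if g: "g \<in> ?cls f" for g
    proof -
      obtain i where i: "i \<in> I" "g = i \<oplus>\<^bsub>P\<^esub> f" using g by (auto simp: a_r_coset_def')
      have "\<phi> n i = \<zero>" using vanish n i(1) \<open>I \<subseteq> J\<close> by blast
      then show ?thesis
        using linear_functionalD(1,2)[OF lin[rule_format, OF n]] f I.Icarr[OF i(1)]
        by (simp add: i(2))
    qed
    then have "\<phi> n ` ?cls f = (\<lambda>_. \<phi> n f) ` ?cls f" by (rule image_cong[OF refl])
    also have "\<dots> = {\<phi> n f}" using I.a_rcos_self[OF f] by blast
    finally show ?thesis by (simp add: \<psi>_def)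
  qed
  have lin': "linear_functional K ?A (\<psi> n)" if n: "n \<in> N" for n
    unfolding linear_functional_def using linear_functionalD[OF lin[rule_format, OF n]]
    by (auto simp: carrier \<psi>[OF n] simp flip: H.f_add H.f_smult)
  have dual': "\<psi> n (?cls (path_vec K m)) = (if m = n then \<one> else \<zero>)" if "m \<in> N" "n \<in> N" for m n
    using that \<psi> dual N(2) by simp
  show "inj_on (\<lambda>p. ?cls (path_vec K p)) N" "V.basis ?B"
    using V.basisI_dual_family[of N "\<lambda>p. ?cls (path_vec K p)" \<psi>] N gen lin' dual' by auto
qed


section \<open>Functionals and ideals given by low-degree coefficients\<close>

context field_path_algebra
begin

lemma linear_functional_coeff: "linear_functional K P (\<lambda>f. f p)"
  by (simp add: linear_functional_def coeff_closed path_algebra_simps)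

lemma linear_functional_weighted_sum:
  assumes "w \<in> S \<rightarrow> carrier K"
  shows "linear_functional K P (\<lambda>f. \<Oplus>p\<in>S. w p \<otimes> f p)"
proof -
  have closed: "w p \<otimes> f p \<in> carrier K" if "p \<in> S" "f \<in> carrier P" for p f
    using that assms coeff_closed by auto
  show ?thesis
    unfolding linear_functional_def
  proof (intro conjI ballI)
    fix f assume f: "f \<in> carrier P"
    show "(\<Oplus>p\<in>S. w p \<otimes> f p) \<in> carrier K" using f closed by (intro finsum_closed) auto
  next
    fix f g assume fg: "f \<in> carrier P" "g \<in> carrier P"
    have "(\<Oplus>p\<in>S. w p \<otimes> (f \<oplus>\<^bsub>P\<^esub> g) p) = (\<Oplus>p\<in>S. w p \<otimes> f p \<oplus> w p \<otimes> g p)"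
      using assms fg closed
      by (intro finsum_cong') (auto simp: path_algebra_simps r_distr coeff_closed Pi_iff)
    then show "(\<Oplus>p\<in>S. w p \<otimes> (f \<oplus>\<^bsub>P\<^esub> g) p) =
        (\<Oplus>p\<in>S. w p \<otimes> f p) \<oplus> (\<Oplus>p\<in>S. w p \<otimes> g p)"
      using fg closed by (simp add: finsum_addf Pi_iff)
  next
    fix c f assume c: "c \<in> carrier K" and f: "f \<in> carrier P"
    have "(\<Oplus>p\<in>S. w p \<otimes> (c \<odot>\<^bsub>P\<^esub> f) p) = (\<Oplus>p\<in>S. c \<otimes> (w p \<otimes> f p))"
      using assms c f closed
      by (intro finsum_cong') (auto simp: path_algebra_simps m_lcomm coeff_closed Pi_iff)
    also have "\<dots> = c \<otimes> (\<Oplus>p\<in>S. w p \<otimes> f p)"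
    proof (cases "finite S")
      case True
      then show ?thesis using c f closed by (simp add: finsum_rdistr Pi_iff)
    next
      case False
      then show ?thesis using c by (simp add: finsum_infinite)
    qed
    finally show "(\<Oplus>p\<in>S. w p \<otimes> (c \<odot>\<^bsub>P\<^esub> f) p) = c \<otimes> (\<Oplus>p\<in>S. w p \<otimes> f p)" .
  qed
qed

lemma weighted_sum_path_vec:
  assumes "finite S" "w \<in> S \<rightarrow> carrier K"
  shows "(\<Oplus>p\<in>S. w p \<otimes> path_vec K m p) = (if m \<in> S then w m else \<zero>)"
proof -
  have "(\<Oplus>p\<in>S. w p \<otimes> path_vec K m p) = (\<Oplus>p\<in>S. if m = p then w p else \<zero>)"
    using assms(2) by (intro finsum_cong') (auto simp: path_vec_def Pi_iff)
  also have "\<dots> = (if m \<in> S then w m else \<zero>)"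
  proof (cases "m \<in> S")
    case True
    then show ?thesis using finsum_singleton[of m S w] assms by simp
  next
    case False
    then have "(\<Oplus>p\<in>S. if m = p then w p else \<zero>) = (\<Oplus>p\<in>S. \<zero>)"
      by (intro finsum_cong') auto
    then show ?thesis using False by simp
  qed
  finally show ?thesis .
qed

text \<open>
  Elements without terms on fewer than \<open>n + 1\<close> vertices form an ideal, and a product with such an
  element acts on its terms on \<open>n + 1\<close> vertices by a scalar that depends only on the two ends of
  the path.  Hence one linear condition for each vertex \<open>x\<close>, on the coefficients of closed paths
  at \<open>x\<close> with \<open>n + 1\<close> vertices, again cuts out an ideal.
\<close>

definition cutoff_ideal ::
  "nat \<Rightarrow> ('v \<Rightarrow> 'v list set) \<Rightarrow> ('v list \<Rightarrow> 'k) \<Rightarrow> ('v list \<Rightarrow> 'k) set" where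
  "cutoff_ideal n S w = {f \<in> carrier P. (\<forall>p. length p \<le> n \<longrightarrow> f p = \<zero>) \<and>
     (\<forall>x. (\<Oplus>p\<in>S x. w p \<otimes> f p) = \<zero>)}"

lemma ideal_cutoff_ideal:
  assumes S: "\<And>x p. p \<in> S x \<Longrightarrow> length p = Suc n \<and> hd p = x \<and> last p = x"
    and w: "\<And>x p. p \<in> S x \<Longrightarrow> w p \<in> carrier K"
  shows "ideal (cutoff_ideal n S w) P"
proof -
  let ?J = "cutoff_ideal n S w"
  define \<psi> where "\<psi> x f = (\<Oplus>p\<in>S x. w p \<otimes> f p)" for x f
  have lin: "linear_functional K P (\<psi> x)" for x
    unfolding \<psi>_def using w by (intro linear_functional_weighted_sum) auto
  have J: "f \<in> ?J \<longleftrightarrow> f \<in> carrier P \<and> (\<forall>p. length p \<le> n \<longrightarrow> f p = \<zero>) \<and> (\<forall>x. \<psi> x f = \<zero>)" for f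
    by (simp add: cutoff_ideal_def \<psi>_def)
  have smult: "c \<odot>\<^bsub>P\<^esub> f \<in> ?J" if "c \<in> carrier K" "f \<in> ?J" for c f
    using that linear_functionalD(3)[OF lin] by (simp add: J) (simp add: path_algebra_simps)
  \<comment> \<open>The factor \<open>c\<close> may vary with the base point but not along \<open>S x\<close>, so it leaves each sum.\<close>
  have scale: "h \<in> ?J"
    if h: "h \<in> carrier P" "\<And>p. length p \<le> n \<Longrightarrow> h p = \<zero>" and f: "f \<in> ?J"
      and c: "\<And>x. c x \<in> carrier K" and hf: "\<And>x p. p \<in> S x \<Longrightarrow> h p = c x \<otimes> f p" for h f c
  proof -
    have "\<psi> x h = \<zero>" for x
    proof -
      have "\<psi> x h = \<psi> x (c x \<odot>\<^bsub>P\<^esub> f)"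
        unfolding \<psi>_def using f c w coeff_closed
        by (intro finsum_cong') (auto simp: J hf path_algebra_simps)
      then show ?thesis using smult[OF c f] by (simp add: J)
    qed
    then show ?thesis using h by (simp add: J)
  qed
  show ?thesis
  proof (rule idealI[OF ring_path_algebra])
    show "subgroup ?J (add_monoid P)"
    proof (rule P.add.subgroupI)
      show "?J \<subseteq> carrier P" by (auto simp: J)
      have "\<zero>\<^bsub>P\<^esub> \<in> ?J"
        using linear_functionalD(3)[OF lin, of \<zero> "\<zero>\<^bsub>P\<^esub>"] linear_functionalD(1)[OF lin, of "\<zero>\<^bsub>P\<^esub>"]
        by (simp add: J) (simp add: path_algebra_simps)
      then show "?J \<noteq> {}" by blast
    next
      fix f assume f: "f \<in> ?J"
      then have "\<ominus>\<^bsub>P\<^esub> f = (\<ominus> \<one>) \<odot>\<^bsub>P\<^esub> f"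
        by (simp add: J PM.smult_l_minus)
      then show "\<ominus>\<^bsub>P\<^esub> f \<in> ?J" using smult[OF _ f] by simp
    next
      fix f g assume "f \<in> ?J" "g \<in> ?J"
      then show "f \<oplus>\<^bsub>P\<^esub> g \<in> ?J"
        using linear_functionalD(2)[OF lin] by (simp add: J) (simp add: path_algebra_simps)
    qed
  next
    fix f g assume f: "f \<in> ?J" and g: "g \<in> carrier P"
    have fP: "f \<in> carrier P" and low: "\<And>p. length p \<le> n \<Longrightarrow> f p = \<zero>" using f by (auto simp: J)
    note [simp] = coeff_closed[OF fP] coeff_closed[OF g]
    have left: "(g \<otimes>\<^bsub>P\<^esub> f) p = g [hd p] \<otimes> f p" if "p \<noteq> []" "length p \<le> Suc n" for p
      using that low path_conv_lowest_right[of f g n p] by (simp add: path_algebra_mult[OF g fP])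
    have right: "(f \<otimes>\<^bsub>P\<^esub> g) p = f p \<otimes> g [last p]" if "p \<noteq> []" "length p \<le> Suc n" for p
      using that low path_conv_lowest_left[of f g n p] by (simp add: path_algebra_mult[OF fP g])
    have nonempty: "p \<noteq> []" "length p \<le> Suc n" if "p \<in> S x" for p x using S[OF that] by auto
    show "g \<otimes>\<^bsub>P\<^esub> f \<in> ?J"
    proof (rule scale[OF _ _ f, of _ "\<lambda>x. g [x]"])
      fix p :: "'v list" assume "length p \<le> n"
      then show "(g \<otimes>\<^bsub>P\<^esub> f) p = \<zero>"
        using left[of p] low[of p] by (cases "p = []") (auto simp: path_algebra_mult[OF g fP])
    qed (use f g fP S left nonempty in auto)
    show "f \<otimes>\<^bsub>P\<^esub> g \<in> ?J"
    proof (rule scale[OF _ _ f, of _ "\<lambda>x. g [x]"])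
      fix p :: "'v list" assume "length p \<le> n"
      then show "(f \<otimes>\<^bsub>P\<^esub> g) p = \<zero>"
        using right[of p] low[of p] by (cases "p = []") (auto simp: path_algebra_mult[OF fP g])
    qed (use f g fP S right nonempty m_comm in auto)
  qed
qed

lemma vwalk_singleton_iff: "vwalk [a] (with_proj Q) \<longleftrightarrow> a \<in> pverts Q"
  by (simp add: vwalk_def)

lemma vwalk_Cons_Cons_iff:
  "vwalk (a # b # p) (with_proj Q) \<longleftrightarrow>
     a \<in> pverts Q \<and> (a, b) \<in> parcs Q \<and> vwalk (b # p) (with_proj Q)"
  by (auto simp: vwalk_def)

lemma path_vec_append_in_ideal:
  assumes "ideal I P" "path_vec K s \<in> I" "s \<noteq> []" "vwalk (s @ t) (with_proj Q)"
  shows "path_vec K (s @ t) \<in> I"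
proof -
  interpret I: ideal I P by fact
  have s: "s = butlast s @ [last s]" using assms(3) by simp
  then have "vwalk (butlast s @ last s # t) (with_proj Q)"
    using assms(4) by (metis append.assoc append_Cons append_Nil)
  then have "vwalk (last s # t) (with_proj Q)"
    using vwalkI_append_r by blast
  then have "path_vec K s \<otimes>\<^bsub>P\<^esub> path_vec K (last s # t) \<in> I"
    by (intro I.I_r_closed assms(2) path_vec_closed)
  then show ?thesis using assms(3) by (simp add: path_vec_mult_path_vec)
qed

text \<open>
  If the relations live on paths with more than \<open>d\<close> vertices and kill all of these, the quotient
  is the truncated path algebra.
\<close>

lemma truncated_path_algebra_basis:
  assumes R: "R \<subseteq> carrier P" "\<forall>r\<in>R. \<forall>p. length p \<le> d \<longrightarrow> r p = \<zero>"
    and N: "N = {p. vwalk p (with_proj Q) \<and> length p \<le> d}" "finite N"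
    and I: "I = Idl\<^bsub>P\<^esub> R"
    and long: "\<forall>p. vwalk p (with_proj Q) \<and> length p > d \<longrightarrow> path_vec K p \<in> I"
  shows "vectorspace K (quot_algebra P I)"
    and "inj_on (\<lambda>p. I +>\<^bsub>P\<^esub> path_vec K p) N"
    and "vectorspace.basis K (quot_algebra P I) ((\<lambda>p. I +>\<^bsub>P\<^esub> path_vec K p) ` N)"
proof -
  let ?J = "cutoff_ideal d (\<lambda>_. {}) (\<lambda>_. \<one>)"
  have J: "ideal ?J P" by (rule ideal_cutoff_ideal) auto
  have RJ: "R \<subseteq> ?J"
    using R unfolding cutoff_ideal_def by (simp add: subset_iff)
  have reduce: "\<forall>p. vwalk p (with_proj Q) \<longrightarrow> p \<in> N \<or> path_vec K p \<in> I \<or>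
      (\<exists>n\<in>N. \<exists>c\<in>carrier K. path_vec K p \<ominus>\<^bsub>P\<^esub> c \<odot>\<^bsub>P\<^esub> path_vec K n \<in> I)"
    using long N(1) not_le by blast
  \<comment> \<open>With no closed paths selected, the cutoff ideal is the span of the paths beyond \<open>d\<close> vertices.\<close>
  define \<phi> :: "'v list \<Rightarrow> ('v list \<Rightarrow> 'k) \<Rightarrow> 'k" where "\<phi> = (\<lambda>n f. f n)"
  have vanish: "\<forall>n\<in>N. \<forall>f\<in>?J. \<phi> n f = \<zero>"
    by (simp add: N(1) cutoff_ideal_def \<phi>_def)
  have dual: "\<forall>n\<in>N. \<forall>m\<in>N. \<phi> n (path_vec K m) = (if m = n then \<one> else \<zero>)"
    by (simp add: path_vec_def \<phi>_def)
  have walk: "\<forall>n\<in>N. vwalk n (with_proj Q)" by (simp add: N(1))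
  have lin: "\<forall>n\<in>N. linear_functional K P (\<phi> n)"
    by (simp add: \<phi>_def linear_functional_coeff)
  note basis = quotient_basis[OF R(1) N(2) walk I reduce J RJ lin vanish dual]
  show "vectorspace K (quot_algebra P I)" "inj_on (\<lambda>p. I +>\<^bsub>P\<^esub> path_vec K p) N"
    "vectorspace.basis K (quot_algebra P I) ((\<lambda>p. I +>\<^bsub>P\<^esub> path_vec K p) ` N)"
    by (rule basis)+
qed

end


section \<open>Simple graphs\<close>

lemma simple_graph_edgeD:
  assumes "simple_graph V E" "{a, b} \<in> E"
  shows "a \<in> V" "b \<in> V" "a \<noteq> b"
  using assms by (auto simp: simple_graph_def)

lemma simple_graph_finite_edges: "simple_graph V E \<Longrightarrow> finite E"
  unfolding simple_graph_def by (auto intro: finite_subset[of E "Pow V"])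

lemma card_arcs_double_graph:
  assumes "simple_graph V E"
  shows "finite {(b, c). {b, c} \<in> E}" "card {(b, c). {b, c} \<in> E} = 2 * card E"
proof -
  have UN: "{(b, c). {b, c} \<in> E} = (\<Union>e\<in>E. {(b, c). {b, c} = e})" by auto
  have two: "finite {(b, c). {b, c} = e} \<and> card {(b, c). {b, c} = e} = 2" if "e \<in> E" for e
  proof -
    have "card e = 2" using assms that by (auto simp: simple_graph_def)
    then obtain a b where "e = {a, b}" "a \<noteq> b" by (meson card_2_iff)
    then have "{(b, c). {b, c} = e} = {(a, b), (b, a)}" by (auto simp: doubleton_eq_iff)
    then show ?thesis using \<open>a \<noteq> b\<close> by simp
  qed
  have fin: "finite E" by (rule simple_graph_finite_edges[OF assms])
  show "finite {(b, c). {b, c} \<in> E}" unfolding UN using fin two by auto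
  have "card (\<Union>e\<in>E. {(b, c). {b, c} = e}) = (\<Sum>e\<in>E. card {(b, c). {b, c} = e})"
    using fin two by (intro card_UN_disjoint) auto
  then show "card {(b, c). {b, c} \<in> E} = 2 * card E" unfolding UN using two by simp
qed

text \<open>
  All uses of connectedness go through this lemma, applied to a single vertex and to the two ends
  of an edge.
\<close>

lemma connected_closed_set_eq_verts:
  assumes graph: "simple_graph V E"
    and conn: "Digraph_Component.connected (with_proj (double_graph V E))"
    and S: "S \<subseteq> V" "S \<noteq> {}" and closed: "\<And>a b. \<lbrakk>a \<in> S; {a, b} \<in> E\<rbrakk> \<Longrightarrow> b \<in> S"
  shows "S = V"
proof
  let ?G = "mk_symmetric (with_proj (double_graph V E))"
  obtain a where a: "a \<in> S" using S by auto
  show "V \<subseteq> S"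
  proof
    fix b assume "b \<in> V"
    then have "(a, b) \<in> rtrancl_on V (parcs ?G)"
      using conn a S by (auto simp: connected_def strongly_connected_def reachable_def double_graph_def)
    then show "b \<in> S"
    proof (induction rule: rtrancl_on_induct)
      case base
      then show ?case using a by simp
    next
      case (step b c)
      then have "{b, c} \<in> E" by (auto simp: parcs_mk_symmetric double_graph_def insert_commute)
      then show ?case using step closed by blast
    qed
  qed
qed (rule S(1))

lemma connected_imp_neighbour:
  assumes "simple_graph V E" "Digraph_Component.connected (with_proj (double_graph V E))"
    and "x \<in> V" "card V \<ge> 2"
  shows "\<exists>y. {x, y} \<in> E"
proof (rule ccontr)
  assume "\<nexists>y. {x, y} \<in> E"
  then have "{x} = V" using assms by (intro connected_closed_set_eq_verts[OF assms(1,2)]) auto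
  then show False using assms(4) by auto
qed

lemma connected_imp_second_neighbour:
  assumes "simple_graph V E" "Digraph_Component.connected (with_proj (double_graph V E))"
    and "{a, b} \<in> E" "card V \<ge> 3"
  obtains c where "c \<noteq> b" "{a, c} \<in> E" | c where "c \<noteq> a" "{b, c} \<in> E"
proof -
  have "card {a, b} \<le> 2" by (simp add: card_insert_if)
  then have "{a, b} \<noteq> V" using assms(4) by auto
  then obtain s c where "s \<in> {a, b}" "{s, c} \<in> E" "c \<notin> {a, b}"
    using connected_closed_set_eq_verts[OF assms(1,2), of "{a, b}"]
      simple_graph_edgeD[OF assms(1,3)] by blast
  then show thesis using that by blast
qed


section \<open>Skew-zigzag algebras\<close>

lemma skew_zigzag_quiver_simps [simp]:
  "pverts (skew_zigzag_quiver V E) = V"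
  "parcs (skew_zigzag_quiver V E) = (if card V = 1 then V \<times> V else {(a, b). {a, b} \<in> E})"
  by (simp_all add: skew_zigzag_quiver_def double_graph_def)

locale skew_zigzag = field K
  for K :: "('k, 'm) ring_scheme" (structure) +
  fixes V :: "'v set" and E :: "'v set set" and v :: "'v \<Rightarrow> 'v \<Rightarrow> 'v \<Rightarrow> 'k"
  assumes graph: "simple_graph V E"
    and conn: "Digraph_Component.connected (with_proj (double_graph V E))"
    and coeffs: "skew_zigzag_coeffs K E v"

sublocale skew_zigzag \<subseteq> field_path_algebra K "skew_zigzag_quiver V E"
  using graph by unfold_locales (simp add: simple_graph_def)

context skew_zigzag
begin

abbreviation Q where "Q \<equiv> skew_zigzag_quiver V E"
abbreviation I where "I \<equiv> skew_zigzag_ideal K V E v"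
abbreviation A where "A \<equiv> skew_zigzag_algebra K V E v"
abbreviation cls where "cls \<equiv> path_class K V E v"

lemma cls_eq: "cls = (\<lambda>p. I +>\<^bsub>P\<^esub> path_vec K p)"
  by (simp add: path_class_def fun_eq_iff)

lemma A_eq: "A = quot_algebra P I"
  by (simp add: skew_zigzag_algebra_def)

lemma I_eq: "I = Idl\<^bsub>P\<^esub> (skew_zigzag_relations K V E v)"
  by (simp add: skew_zigzag_ideal_def)

lemma edgeD:
  assumes "{a, b} \<in> E"
  shows "a \<in> V" "b \<in> V" "a \<noteq> b" "{b, a} \<in> E"
  using simple_graph_edgeD[OF graph assms] assms by (simp_all add: insert_commute)

lemma one_vertex_basis:
  assumes V: "V = {x}"
  shows "vectorspace K A" "distinct [\<one>\<^bsub>A\<^esub>, cls [x, x]]"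
    and "vectorspace.basis K A {\<one>\<^bsub>A\<^esub>, cls [x, x]}"
proof -
  let ?R = "skew_zigzag_relations K V E v"
  have mem: "z \<in> V \<longleftrightarrow> z = x" for z using V by simp
  have card: "card V = 1" using V by simp
  have walk: "vwalk p (with_proj Q) \<longleftrightarrow> p \<noteq> [] \<and> set p \<subseteq> {x}" for p
  proof (induction p rule: induct_list012)
    case (3 a b p)
    then show ?case using mem card by (auto simp: vwalk_Cons_Cons_iff)
  qed (use mem in \<open>auto simp: vwalk_singleton_iff vwalk_def\<close>)
  have R: "?R = {path_vec K [x, x, x]}"
    using path_vec_mult_path_vec[of "[x, x]" "[x, x]"]
    by (simp add: skew_zigzag_relations_def Let_def mem card)
  have RP: "?R \<subseteq> carrier P" using walk[of "[x, x, x]"] by (simp add: R)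
  have low: "\<forall>r\<in>?R. \<forall>p. length p \<le> 2 \<longrightarrow> r p = \<zero>"
    by (auto simp: R path_vec_def)
  have N: "{[x], [x, x]} = {p. vwalk p (with_proj Q) \<and> length p \<le> 2}"
  proof (intro equalityI subsetI)
    fix p assume "p \<in> {p. vwalk p (with_proj Q) \<and> length p \<le> 2}"
    then show "p \<in> {[x], [x, x]}"
      by (auto simp: walk le_Suc_eq length_Suc_conv numeral_eq_Suc)
  qed (auto simp: walk)
  have long: "\<forall>p. vwalk p (with_proj Q) \<and> length p > 2 \<longrightarrow> path_vec K p \<in> I"
  proof (intro allI impI, elim conjE)
    fix p assume p: "vwalk p (with_proj Q)" "length p > 2"
    obtain a b c t where "p = a # b # c # t"
      using p(2) by (auto simp: numeral_eq_Suc less_eq_Suc_le Suc_le_length_iff)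
    then have eq: "p = [x, x, x] @ t" using p(1) by (auto simp: walk)
    have "path_vec K [x, x, x] \<in> I" using P.genideal_self[OF RP] by (simp add: I_eq R)
    moreover have "ideal I P" unfolding I_eq by (rule P.genideal_ideal[OF RP])
    ultimately show "path_vec K p \<in> I"
      using path_vec_append_in_ideal[of I "[x, x, x]" t] p(1) unfolding eq by blast
  qed
  have fin: "finite {[x], [x, x]}" by simp
  note basis = truncated_path_algebra_basis[OF RP low N fin I_eq long]
  have one: "\<one>\<^bsub>A\<^esub> = cls [x]"
  proof -
    have "\<one>\<^bsub>P\<^esub> = path_vec K [x]"
      by (auto simp: path_algebra_simps path_vec_def mem fun_eq_iff)
    then show ?thesis by (simp add: A_eq quot_algebra_simps cls_eq)
  qed
  show "vectorspace K A" using basis(1) by (simp add: A_eq)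
  show "distinct [\<one>\<^bsub>A\<^esub>, cls [x, x]]" using basis(2) by (simp add: one cls_eq)
  show "vectorspace.basis K A {\<one>\<^bsub>A\<^esub>, cls [x, x]}" using basis(3) unfolding one by (simp add: A_eq cls_eq)
qed

lemma two_vertices_basis:
  assumes V: "V = {a, b}" and ab: "a \<noteq> b"
  shows "vectorspace K A"
    and "distinct [cls [a], cls [b], cls [a, b], cls [b, a], cls [a, b, a], cls [b, a, b]]"
    and "vectorspace.basis K A
      {cls [a], cls [b], cls [a, b], cls [b, a], cls [a, b, a], cls [b, a, b]}"
proof -
  let ?R = "skew_zigzag_relations K V E v"
  let ?N = "{[a], [b], [a, b], [b, a], [a, b, a], [b, a, b]}"
  have card: "card V = 2" using V ab by simp
  have mem: "z \<in> V \<longleftrightarrow> z = a \<or> z = b" for z using V by simp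
  have Q: "Q = double_graph V E" by (simp add: skew_zigzag_quiver_def card)
  obtain c where c: "{a, c} \<in> E" using connected_imp_neighbour[OF graph conn, of a] V card by auto
  then have "c = b" using edgeD[OF c] V by auto
  then have E: "{x, y} \<in> E \<longleftrightarrow> {x, y} = {a, b}" for x y
    using c edgeD[of x y] V by (auto simp: doubleton_eq_iff insert_commute)
  have R: "?R = {path_vec K p | p. vwalk p (with_proj Q) \<and> length p > 3}"
    by (auto simp: skew_zigzag_relations_def card Q)
  have RP: "?R \<subseteq> carrier P" by (auto simp: R)
  have low: "\<forall>r\<in>?R. \<forall>p. length p \<le> 3 \<longrightarrow> r p = \<zero>"
    by (auto simp: R path_vec_def)
  have N: "?N = {p. vwalk p (with_proj Q) \<and> length p \<le> 3}"
  proof (intro equalityI subsetI)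
    fix p assume p: "p \<in> {p. vwalk p (with_proj Q) \<and> length p \<le> 3}"
    then consider "p = []" | x where "p = [x]" | x y where "p = [x, y]" | x y z where "p = [x, y, z]"
      by (auto simp: le_Suc_eq length_Suc_conv numeral_eq_Suc)
    then show "p \<in> ?N"
      using p ab by cases (auto simp: vwalk_Cons_Cons_iff vwalk_singleton_iff card E mem doubleton_eq_iff vwalk_def)
  qed (use ab in \<open>auto simp: vwalk_Cons_Cons_iff vwalk_singleton_iff card mem E doubleton_eq_iff\<close>)
  have long: "\<forall>p. vwalk p (with_proj Q) \<and> length p > 3 \<longrightarrow> path_vec K p \<in> I"
    using P.genideal_self[OF RP] unfolding I_eq R by blast
  have fin: "finite ?N" by simp
  note basis = truncated_path_algebra_basis[OF RP low N fin I_eq long]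
  show "vectorspace K A" using basis(1) by (simp add: A_eq)
  have "distinct (map cls [[a], [b], [a, b], [b, a], [a, b, a], [b, a, b]])"
    unfolding distinct_map using basis(2) ab by (simp add: cls_eq)
  then show "distinct [cls [a], cls [b], cls [a, b], cls [b, a], cls [a, b, a], cls [b, a, b]]"
    by simp
  show "vectorspace.basis K A
      {cls [a], cls [b], cls [a, b], cls [b, a], cls [a, b, a], cls [b, a, b]}"
    using basis(3) by (simp add: A_eq cls_eq)
qed

text \<open>
  The cocycle condition in transitive form.  It says that the scalars \<open>v x a b\<close> are ratios of weights
  on the neighbours of \<open>x\<close>, so that the cycles at \<open>x\<close> can be compared consistently.
\<close>

lemma coeffs_chain:
  assumes "{x, a} \<in> E" "{x, b} \<in> E" "{x, c} \<in> E"
  shows "v x a b \<otimes> v x b c = v x a c"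
proof -
  have closed: "v x a b \<in> carrier K" "v x b c \<in> carrier K" "v x c a \<in> carrier K" "v x a c \<in> carrier K"
    using coeffs assms by (auto simp: skew_zigzag_coeffs_def)
  have "v x a b \<otimes> v x b c = v x a b \<otimes> v x b c \<otimes> (v x c a \<otimes> v x a c)"
    using coeffs assms closed by (simp add: skew_zigzag_coeffs_def)
  also have "\<dots> = v x a b \<otimes> v x b c \<otimes> v x c a \<otimes> v x a c"
    using closed by (simp add: m_assoc)
  also have "\<dots> = v x a c"
    using coeffs assms closed by (simp add: skew_zigzag_coeffs_def)
  finally show ?thesis .
qed

lemma skew_zigzag_relations_ge3:
  assumes "card V \<ge> 3"
  shows "skew_zigzag_relations K V E v =
    {path_vec K [a, b, c] | a b c. {a, b} \<in> E \<and> {b, c} \<in> E \<and> a \<noteq> c} \<union>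
    {path_vec K [a, b, a] \<ominus>\<^bsub>P\<^esub> v a b c \<odot>\<^bsub>P\<^esub> path_vec K [a, c, a] | a b c. {a, b} \<in> E \<and> {a, c} \<in> E}"
  using assms by (simp add: skew_zigzag_relations_def Let_def)

lemma vwalk_ge3:
  assumes "card V \<ge> 3"
  shows "vwalk [a] (with_proj Q) \<longleftrightarrow> a \<in> V"
    and "vwalk (a # b # p) (with_proj Q) \<longleftrightarrow> {a, b} \<in> E \<and> vwalk (b # p) (with_proj Q)"
  using assms edgeD[of a b]
  by (auto simp: vwalk_singleton_iff vwalk_Cons_Cons_iff)

lemma coeff_closed_edges: "\<lbrakk>{a, b} \<in> E; {a, c} \<in> E\<rbrakk> \<Longrightarrow> v a b c \<in> carrier K"
  using coeffs by (auto simp: skew_zigzag_coeffs_def)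

lemma skew_zigzag_relations_closed:
  assumes "card V \<ge> 3"
  shows "skew_zigzag_relations K V E v \<subseteq> carrier P"
proof -
  have "path_vec K [a, b, c] \<in> carrier P" if "{a, b} \<in> E" "{b, c} \<in> E" for a b c
    using that edgeD[of b c] by (intro path_vec_closed) (simp add: vwalk_ge3[OF assms])
  then show ?thesis
    unfolding skew_zigzag_relations_ge3[OF assms]
    using edgeD(4) coeff_closed_edges by (auto intro!: P.minus_closed PM.smult_closed)
qed

lemma ideal_I_ge3: "card V \<ge> 3 \<Longrightarrow> ideal I P"
  unfolding I_eq by (rule P.genideal_ideal[OF skew_zigzag_relations_closed])

lemma relation_in_I:
  assumes "card V \<ge> 3"
  shows "\<lbrakk>{a, b} \<in> E; {b, c} \<in> E; a \<noteq> c\<rbrakk> \<Longrightarrow> path_vec K [a, b, c] \<in> I"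
    and "\<lbrakk>{a, b} \<in> E; {a, c} \<in> E\<rbrakk> \<Longrightarrow>
           path_vec K [a, b, a] \<ominus>\<^bsub>P\<^esub> v a b c \<odot>\<^bsub>P\<^esub> path_vec K [a, c, a] \<in> I"
proof -
  have sub: "skew_zigzag_relations K V E v \<subseteq> I"
    unfolding I_eq by (rule P.genideal_self[OF skew_zigzag_relations_closed[OF assms]])
  show "\<lbrakk>{a, b} \<in> E; {b, c} \<in> E; a \<noteq> c\<rbrakk> \<Longrightarrow> path_vec K [a, b, c] \<in> I"
    by (rule subsetD[OF sub]) (auto simp: skew_zigzag_relations_ge3[OF assms])
  show "\<lbrakk>{a, b} \<in> E; {a, c} \<in> E\<rbrakk> \<Longrightarrow>
      path_vec K [a, b, a] \<ominus>\<^bsub>P\<^esub> v a b c \<odot>\<^bsub>P\<^esub> path_vec K [a, c, a] \<in> I"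
    by (rule subsetD[OF sub]) (auto simp: skew_zigzag_relations_ge3[OF assms])
qed

text \<open>
  Only the paths \<open>(a|b|a|b)\<close> do not contain a relation of the first kind.  For them a second
  neighbour \<open>x\<close> of \<open>a\<close> or \<open>b\<close> is needed: turning the cycle through the edge into a cycle through
  \<open>x\<close> creates a subpath with different ends.  On two vertices there is no such \<open>x\<close>, which is why
  that algebra is defined separately.
\<close>

lemma path_of_length_three_in_I:
  assumes V: "card V \<ge> 3" and e: "{a, b} \<in> E" "{b, c} \<in> E" "{c, d} \<in> E"
  shows "path_vec K [a, b, c, d] \<in> I"
proof -
  interpret I: ideal I P by (rule ideal_I_ge3[OF V])
  have closed: "path_vec K [x, y] \<in> carrier P" if "{x, y} \<in> E" for x y
    using that edgeD[of x y] by (intro path_vec_closed) (simp add: vwalk_ge3[OF V])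
  have closed3: "path_vec K [x, y, z] \<in> carrier P" if "{x, y} \<in> E" "{y, z} \<in> E" for x y z
    using that edgeD[of y z] by (intro path_vec_closed) (simp add: vwalk_ge3[OF V])
  have left: "path_vec K [x, y, z, w] \<in> I" if "{x, y} \<in> E" "{y, z} \<in> E" "{z, w} \<in> E" "x \<noteq> z" for x y z w
    using I.I_r_closed[OF relation_in_I(1)[OF V that(1,2,4)] closed[OF that(3)]]
    by (simp add: path_vec_mult_path_vec)
  have right: "path_vec K [x, y, z, w] \<in> I" if "{x, y} \<in> E" "{y, z} \<in> E" "{z, w} \<in> E" "y \<noteq> w" for x y z w
    using I.I_l_closed[OF relation_in_I(1)[OF V that(2,3,4)] closed[OF that(1)]]
    by (simp add: path_vec_mult_path_vec)
  note smult = smult_in_ideal[OF I.is_ideal]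
  have cancel: "f \<in> I" if "f \<ominus>\<^bsub>P\<^esub> g \<in> I" "g \<in> I" "f \<in> carrier P" for f g
  proof -
    have "f = (f \<ominus>\<^bsub>P\<^esub> g) \<oplus>\<^bsub>P\<^esub> g"
      using that(3) I.Icarr[OF that(2)] by (simp add: P.minus_eq P.a_assoc P.l_neg)
    then show ?thesis using I.a_closed[OF that(1,2)] by simp
  qed
  show ?thesis
  proof (cases "a = c \<and> b = d")
    case False
    then show ?thesis using left right e by blast
  next
    case True
    have p4: "path_vec K [a, b, a, b] \<in> carrier P"
      using edgeD[OF e(1)] e(1) by (intro path_vec_closed) (simp add: vwalk_ge3[OF V])
    have "path_vec K [a, b, a, b] \<in> I"
    proof (rule connected_imp_second_neighbour[OF graph conn e(1) V])
      fix x assume x: "x \<noteq> b" "{a, x} \<in> E"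
      let ?k = "v a b x"
      have k: "?k \<in> carrier K" using coeff_closed_edges e(1) x(2) by simp
      have fs: "path_vec K [a, b, a] \<in> carrier P" "path_vec K [a, x, a] \<in> carrier P"
        "path_vec K [a, b] \<in> carrier P"
        using closed closed3 e x edgeD by auto
      have "(path_vec K [a, b, a] \<ominus>\<^bsub>P\<^esub> ?k \<odot>\<^bsub>P\<^esub> path_vec K [a, x, a]) \<otimes>\<^bsub>P\<^esub> path_vec K [a, b] \<in> I"
        by (rule I.I_r_closed[OF relation_in_I(2)[OF V e(1) x(2)] fs(3)])
      also have "(path_vec K [a, b, a] \<ominus>\<^bsub>P\<^esub> ?k \<odot>\<^bsub>P\<^esub> path_vec K [a, x, a]) \<otimes>\<^bsub>P\<^esub> path_vec K [a, b] =
          path_vec K [a, b, a, b] \<ominus>\<^bsub>P\<^esub> ?k \<odot>\<^bsub>P\<^esub> path_vec K [a, x, a, b]"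
        using fs k
        by (simp add: P.minus_eq P.l_distr P.l_minus path_algebra_smult_mult path_vec_mult_path_vec)
      finally show ?thesis
        by (rule cancel[OF _ smult[OF k right[OF x(2) edgeD(4)[OF x(2)] e(1) x(1)]] p4])
    next
      fix x assume x: "x \<noteq> a" "{b, x} \<in> E"
      let ?k = "v b a x"
      have k: "?k \<in> carrier K" using coeff_closed_edges edgeD(4)[OF e(1)] x(2) by simp
      have fs: "path_vec K [b, a, b] \<in> carrier P" "path_vec K [b, x, b] \<in> carrier P"
        "path_vec K [a, b] \<in> carrier P"
        using closed closed3 e x edgeD by auto
      have "path_vec K [a, b] \<otimes>\<^bsub>P\<^esub> (path_vec K [b, a, b] \<ominus>\<^bsub>P\<^esub> ?k \<odot>\<^bsub>P\<^esub> path_vec K [b, x, b]) \<in> I"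
        by (rule I.I_l_closed[OF relation_in_I(2)[OF V edgeD(4)[OF e(1)] x(2)] fs(3)])
      also have "path_vec K [a, b] \<otimes>\<^bsub>P\<^esub> (path_vec K [b, a, b] \<ominus>\<^bsub>P\<^esub> ?k \<odot>\<^bsub>P\<^esub> path_vec K [b, x, b]) =
          path_vec K [a, b, a, b] \<ominus>\<^bsub>P\<^esub> ?k \<odot>\<^bsub>P\<^esub> path_vec K [a, b, x, b]"
        using fs k
        by (simp add: P.minus_eq P.r_distr P.r_minus path_algebra_smult_mult path_vec_mult_path_vec)
      finally show ?thesis
        by (rule cancel[OF _ smult[OF k left[OF e(1) x(2) edgeD(4)[OF x(2)] x(1)[symmetric]]] p4])
    qed
    then show ?thesis using True by simp
  qed
qed

definition zigzag_normal_paths :: "('v \<Rightarrow> 'v) \<Rightarrow> 'v list set" where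
  "zigzag_normal_paths y =
     {[a] | a. a \<in> V} \<union> {[b, c] | b c. {b, c} \<in> E} \<union> {[x, y x, x] | x. x \<in> V}"

lemma zigzag_normal_paths_card:
  shows "finite (zigzag_normal_paths y)"
    and "card (zigzag_normal_paths y) = 2 * card V + 2 * card E"
proof -
  have eq: "zigzag_normal_paths y =
      (\<lambda>a. [a]) ` V \<union> ((\<lambda>(b, c). [b, c]) ` {(b, c). {b, c} \<in> E} \<union> (\<lambda>x. [x, y x, x]) ` V)"
    unfolding zigzag_normal_paths_def by auto
  have finV: "finite V" using graph by (simp add: simple_graph_def)
  show "finite (zigzag_normal_paths y)"
    unfolding eq using card_arcs_double_graph(1)[OF graph] finV by simp
  have "card ((\<lambda>(b, c). [b, c]) ` {(b, c). {b, c} \<in> E}) = 2 * card E"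
    using card_arcs_double_graph(2)[OF graph] by (subst card_image) (auto simp: inj_on_def)
  moreover have "card ((\<lambda>a. [a]) ` V) = card V" "card ((\<lambda>x. [x, y x, x]) ` V) = card V"
    by (auto intro!: card_image simp: inj_on_def)
  ultimately show "card (zigzag_normal_paths y) = 2 * card V + 2 * card E"
    unfolding eq using card_arcs_double_graph(1)[OF graph] finV
    by (subst card_Un_disjoint; (subst card_Un_disjoint)?) auto
qed

lemma zigzag_path_reduction:
  assumes V: "card V \<ge> 3" and y: "\<And>x. x \<in> V \<Longrightarrow> {x, y x} \<in> E"
  shows "\<forall>p. vwalk p (with_proj Q) \<longrightarrow> p \<in> zigzag_normal_paths y \<or> path_vec K p \<in> I \<or>
    (\<exists>n\<in>zigzag_normal_paths y. \<exists>c\<in>carrier K. path_vec K p \<ominus>\<^bsub>P\<^esub> c \<odot>\<^bsub>P\<^esub> path_vec K n \<in> I)"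
proof (intro allI impI)
  fix p assume p: "vwalk p (with_proj Q)"
  let ?reduces = "p \<in> zigzag_normal_paths y \<or> path_vec K p \<in> I \<or>
    (\<exists>n\<in>zigzag_normal_paths y. \<exists>c\<in>carrier K. path_vec K p \<ominus>\<^bsub>P\<^esub> c \<odot>\<^bsub>P\<^esub> path_vec K n \<in> I)"
  note walk = vwalk_ge3[OF V]
  consider "p = []" | a where "p = [a]" | a b where "p = [a, b]" | a b c where "p = [a, b, c]"
    | a b c d t where "p = a # b # c # d # t"
    by (metis list.exhaust)
  then show ?reduces
  proof cases
    case 1
    then show ?reduces using p by (auto simp: vwalk_def)
  next
    case (2 a)
    then show ?reduces using p by (auto simp: walk zigzag_normal_paths_def)
  next
    case (3 a b)
    then show ?reduces using p by (auto simp: walk zigzag_normal_paths_def)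
  next
    case (4 a b c)
    then have e: "{a, b} \<in> E" "{b, c} \<in> E" using p by (auto simp: walk)
    show ?reduces
    proof (cases "a = c")
      case True
      have aV: "a \<in> V" using edgeD(1)[OF e(1)] .
      have "[a, y a, a] \<in> zigzag_normal_paths y" using aV by (auto simp: zigzag_normal_paths_def)
      moreover have "v a b (y a) \<in> carrier K" using e y[OF aV] coeff_closed_edges by simp
      moreover have "path_vec K p \<ominus>\<^bsub>P\<^esub> v a b (y a) \<odot>\<^bsub>P\<^esub> path_vec K [a, y a, a] \<in> I"
        using relation_in_I(2)[OF V e(1) y[OF aV]] True 4 by simp
      ultimately show ?reduces by blast
    next
      case False
      then show ?reduces using relation_in_I(1)[OF V e] 4 by simp
    qed
  next
    case (5 a b c d t)
    then have "path_vec K [a, b, c, d] \<in> I"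
      using p by (intro path_of_length_three_in_I[OF V]) (auto simp: walk)
    then show ?reduces
      using path_vec_append_in_ideal[OF ideal_I_ge3[OF V], of "[a, b, c, d]" t] p 5 by simp
  qed
qed

lemma three_vertices_basis:
  assumes V: "card V \<ge> 3" and y: "\<And>x. x \<in> V \<Longrightarrow> {x, y x} \<in> E"
  shows "vectorspace K A" "inj_on cls (zigzag_normal_paths y)"
    and "vectorspace.basis K A (cls ` zigzag_normal_paths y)"
proof -
  let ?N = "zigzag_normal_paths y" and ?R = "skew_zigzag_relations K V E v"
  define S where "S x = {[x, z, x] | z. {x, z} \<in> E}" for x
  \<comment> \<open>In the quotient \<open>[x|z|x] = w [x, z, x] [x|y\<^sub>x|x]\<close>, so the weighted sum computes the
    coordinate at \<open>[x|y\<^sub>x|x]\<close>.\<close>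
  define w where "w p = v (hd p) (p ! 1) (y (hd p))" for p
  define \<phi> where "\<phi> n f = (if length n \<le> 2 then f n else (\<Oplus>p\<in>S (hd n). w p \<otimes> f p))" for n f
  let ?J = "cutoff_ideal 2 S w"
  note walk = vwalk_ge3[OF V]
  have finS: "finite (S x)" for x
  proof -
    have "S x \<subseteq> (\<lambda>z. [x, z, x]) ` V" using edgeD by (auto simp: S_def)
    then show ?thesis using graph by (auto simp: simple_graph_def intro: finite_subset)
  qed
  have wS: "w p \<in> carrier K" if "p \<in> S x" for x p
    using that y edgeD(1) coeff_closed_edges by (auto simp: S_def w_def)
  then have w: "w \<in> S x \<rightarrow> carrier K" for x by auto
  have J: "ideal ?J P"
    by (rule ideal_cutoff_ideal) (auto simp: S_def wS[unfolded S_def])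
  have sum_vec: "(\<Oplus>p\<in>S x. w p \<otimes> path_vec K m p) = (if m \<in> S x then w m else \<zero>)" for x m
    by (rule weighted_sum_path_vec[OF finS w])
  have RJ: "?R \<subseteq> ?J"
  proof
    fix r assume r: "r \<in> ?R"
    then have rP: "r \<in> carrier P" using skew_zigzag_relations_closed[OF V] by blast
    from r consider (ends) a b c where "a \<noteq> c" "r = path_vec K [a, b, c]"
      | (loops) a b c where "{a, b} \<in> E" "{a, c} \<in> E"
          "r = path_vec K [a, b, a] \<ominus>\<^bsub>P\<^esub> v a b c \<odot>\<^bsub>P\<^esub> path_vec K [a, c, a]"
      unfolding skew_zigzag_relations_ge3[OF V] by blast
    then show "r \<in> ?J"
    proof cases
      case ends
      have "r p = \<zero>" if "length p \<le> 2" for p using that ends by (auto simp: path_vec_def)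
      moreover have "[a, b, c] \<notin> S x" for x using ends by (auto simp: S_def)
      ultimately show ?thesis using rP by (simp add: cutoff_ideal_def ends(2) sum_vec)
    next
      case loops
      define k where "k = \<ominus> v a b c"
      have kc: "v a b c \<in> carrier K" using loops by (simp add: coeff_closed_edges)
      have fs: "path_vec K [a, b, a] \<in> carrier P" "path_vec K [a, c, a] \<in> carrier P"
        using loops edgeD by (auto intro!: path_vec_closed simp: walk)
      have r: "r = path_vec K [a, b, a] \<oplus>\<^bsub>P\<^esub> k \<odot>\<^bsub>P\<^esub> path_vec K [a, c, a]"
        using loops(3) fs kc by (simp add: P.minus_eq k_def PM.smult_l_minus)
      have k: "k \<in> carrier K" using kc by (simp add: k_def)
      have low: "r p = \<zero>" if "length p \<le> 2" for p
        using that k by (auto simp: r path_algebra_simps path_vec_def)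
      have "(\<Oplus>p\<in>S x. w p \<otimes> r p) = \<zero>" for x
      proof -
        note lin = linear_functionalD[OF linear_functional_weighted_sum[OF w[of x]]]
        have "(\<Oplus>p\<in>S x. w p \<otimes> r p) = (\<Oplus>p\<in>S x. w p \<otimes> path_vec K [a, b, a] p) \<oplus>
            k \<otimes> (\<Oplus>p\<in>S x. w p \<otimes> path_vec K [a, c, a] p)"
          unfolding r using fs k by (subst lin(2)) (auto simp: lin(3))
        also have "\<dots> = \<zero>"
        proof (cases "x = a")
          case True
          have ya: "{a, y a} \<in> E" using y edgeD(1)[OF loops(1)] by simp
          have mem: "[a, b, a] \<in> S x" "[a, c, a] \<in> S x" using True loops by (auto simp: S_def)
          have closed: "v a c (y a) \<in> carrier K" "v a b (y a) \<in> carrier K"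
            using loops ya by (simp_all add: coeff_closed_edges)
          have "k \<otimes> v a c (y a) = \<ominus> v a b (y a)"
            using coeffs_chain[OF loops(1,2) ya] kc closed by (simp add: k_def l_minus)
          then show ?thesis unfolding sum_vec using mem closed by (simp add: w_def r_neg)
        next
          case False
          then have "[a, b, a] \<notin> S x" "[a, c, a] \<notin> S x" by (auto simp: S_def)
          then show ?thesis using k by (simp add: sum_vec)
        qed
        finally show ?thesis .
      qed
      then show ?thesis using rP low by (simp add: cutoff_ideal_def)
    qed
  qed
  have lin: "linear_functional K P (\<phi> n)" if "n \<in> ?N" for n
  proof (cases "length n \<le> 2")
    case True
    then show ?thesis using linear_functional_coeff[of n] by (simp add: \<phi>_def[abs_def])
  next
    case False
    then show ?thesis
      using linear_functional_weighted_sum[OF w[of "hd n"]] by (simp add: \<phi>_def[abs_def])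
  qed
  have vanish: "\<phi> n f = \<zero>" if "n \<in> ?N" "f \<in> ?J" for n f
    using that(2) by (simp add: \<phi>_def cutoff_ideal_def)
  have dual: "\<phi> n (path_vec K m) = (if m = n then \<one> else \<zero>)" if mn: "m \<in> ?N" "n \<in> ?N" for m n
  proof (cases "length n \<le> 2")
    case True
    then show ?thesis by (simp add: \<phi>_def path_vec_def)
  next
    case False
    then obtain x where x: "x \<in> V" "n = [x, y x, x]" using mn(2) by (auto simp: zigzag_normal_paths_def)
    have "m \<in> S x \<longleftrightarrow> m = n"
      using mn(1) x y by (auto simp: S_def zigzag_normal_paths_def)
    moreover have "w n = \<one>" using coeffs y x by (simp add: w_def skew_zigzag_coeffs_def)
    ultimately show ?thesis using x by (simp add: \<phi>_def sum_vec)
  qed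
  have walkN: "vwalk n (with_proj Q)" if "n \<in> ?N" for n
    using that y edgeD by (fastforce simp: zigzag_normal_paths_def walk)
  note RP = skew_zigzag_relations_closed[OF V] and red = zigzag_path_reduction[OF V y]
    and fin = zigzag_normal_paths_card(1)[of y]
  have "\<forall>n\<in>?N. vwalk n (with_proj Q)" "\<forall>n\<in>?N. linear_functional K P (\<phi> n)"
    "\<forall>n\<in>?N. \<forall>f\<in>?J. \<phi> n f = \<zero>"
    "\<forall>n\<in>?N. \<forall>m\<in>?N. \<phi> n (path_vec K m) = (if m = n then \<one> else \<zero>)"
    using walkN lin vanish dual by blast+
  note basis = quotient_basis[OF RP fin this(1) I_eq red J RJ this(2-4)]
  show "vectorspace K A" unfolding A_eq by (rule basis(1))
  show "inj_on cls ?N" unfolding cls_eq by (rule basis(2))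
  show "vectorspace.basis K A (cls ` ?N)" unfolding A_eq cls_eq by (rule basis(3))
qed

end


theorem proposition3p7:
  fixes K :: "('k, 'm) ring_scheme"
    and V :: "'v set" and E :: "'v set set"
    and v :: "'v \<Rightarrow> 'v \<Rightarrow> 'v \<Rightarrow> 'k"
  assumes "field K"
    and "simple_graph V E"
    and "Digraph_Component.connected (with_proj (double_graph V E))"
    and "skew_zigzag_coeffs K E v"
  defines "A \<equiv> skew_zigzag_algebra K V E v"
    and "cls \<equiv> path_class K V E v"
  shows "vectorspace K A \<and>
    (\<forall>x. V = {x} \<longrightarrow>
      distinct [\<one>\<^bsub>A\<^esub>, cls [x, x]] \<and>
      vectorspace.basis K A {\<one>\<^bsub>A\<^esub>, cls [x, x]}) \<and>
    (\<forall>a b. V = {a, b} \<and> a \<noteq> b \<longrightarrow>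
      distinct [cls [a], cls [b], cls [a, b], cls [b, a], cls [a, b, a], cls [b, a, b]] \<and>
      vectorspace.basis K A
        {cls [a], cls [b], cls [a, b], cls [b, a], cls [a, b, a], cls [b, a, b]}) \<and>
    (card V \<ge> 3 \<longrightarrow>
      (\<forall>y. (\<forall>x\<in>V. {x, y x} \<in> E) \<longrightarrow>
        vectorspace.basis K A
          ({cls [a] | a. a \<in> V} \<union> {cls [b, c] | b c. {b, c} \<in> E} \<union> {cls [x, y x, x] | x. x \<in> V})) \<and>
      vectorspace.fin_dim K A \<and> vectorspace.dim K A = 2 * card V + 2 * card E)"
proof -
  interpret Z: skew_zigzag K V E v
    by (intro skew_zigzag.intro skew_zigzag_axioms.intro assms)
  have neighbours: "\<exists>y. \<forall>x\<in>V. {x, y x} \<in> E" if "card V \<ge> 3"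
    using connected_imp_neighbour[OF Z.graph Z.conn] that by (intro bchoice) auto
  have vs: "vectorspace K A"
  proof -
    have "finite V" using Z.graph by (simp add: simple_graph_def)
    moreover have "V \<noteq> {}"
      using Z.conn by (auto simp: connected_def strongly_connected_def double_graph_def)
    ultimately have "card V > 0" by (simp add: card_gt_0_iff)
    then consider "card V = 1" | "card V = 2" | "card V \<ge> 3" by linarith
    then show ?thesis
    proof cases
      case 1
      then obtain x where "V = {x}" by (auto simp: card_1_singleton_iff)
      then show ?thesis unfolding A_def by (rule Z.one_vertex_basis(1))
    next
      case 2
      then obtain a b where "V = {a, b}" "a \<noteq> b" by (auto simp: card_2_iff)
      then show ?thesis unfolding A_def by (rule Z.two_vertices_basis(1))
    next
      case 3
      then show ?thesis
        using neighbours[OF 3] Z.three_vertices_basis(1)[OF 3] unfolding A_def by blast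
    qed
  qed
  interpret vectorspace K A by (rule vs)
  have classes: "{cls [a] | a. a \<in> V} \<union> {cls [b, c] | b c. {b, c} \<in> E} \<union>
      {cls [x, y x, x] | x. x \<in> V} = cls ` Z.zigzag_normal_paths y" for y
    unfolding Z.zigzag_normal_paths_def image_Un by (auto simp: image_iff)
  have basis: "basis (cls ` Z.zigzag_normal_paths y)" "inj_on cls (Z.zigzag_normal_paths y)"
    if "card V \<ge> 3" "\<forall>x\<in>V. {x, y x} \<in> E" for y
    using Z.three_vertices_basis[of y] that by (auto simp: A_def cls_def)
  have dim: "fin_dim \<and> dim = 2 * card V + 2 * card E" if V: "card V \<ge> 3"
  proof -
    obtain y where y: "\<forall>x\<in>V. {x, y x} \<in> E" using neighbours[OF V] by blast
    note B = basis[OF V y]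
    have fin: "finite (cls ` Z.zigzag_normal_paths y)"
      using Z.zigzag_normal_paths_card(1) by blast
    have "fin_dim" using fin B(1) unfolding fin_dim_def basis_def by blast
    moreover have "dim = card (cls ` Z.zigzag_normal_paths y)" by (rule dim_basis[OF fin B(1)])
    ultimately show ?thesis
      using card_image[OF B(2)] Z.zigzag_normal_paths_card(2)[of y] by simp
  qed
  show ?thesis
    unfolding classes using vs Z.one_vertex_basis Z.two_vertices_basis basis dim
    unfolding A_def cls_def by blast
qed

end
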